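(* Assume that $a$ and $b$ are not both in $\mathbb{F}_q$. Then: (a) if the integer $e_1$ does not exist (which includes the case $\Delta=0$), then for any integer $i\ge 1$, $e_i'=p^{i-1}e_1'$; (b) if $e_1$ exists and $e_1'<e_1$, then for any integer $i\ge 1$, $e_i'=p^{i-1}e_1'$; (c) if $\Delta\not\equiv 0\pmod P$, then for any integer $i\ge 1$, $e_i'=p^{i-1}e_1'$; (d) if $p>2$, $\Delta\equiv 0\pmod P$, $e_1$ exists and $e_1'=e_1$, let $k=\mathrm{ord}_P(a/2)$ and $m=v_P((a/2)^k-1)$; then for any integer $i\ge 2$, $$e_i'=\min\left\{mp^i,\ \frac{(p^i-1)e_1}{p-1}\right\};$$ (e) if $p=2$, $\Delta\equiv 0\pmod P$, $e_1$ exists and $e_1'=e_1$, let $k=\mathrm{ord}_P(b)$ and $m=v_P(b^k-1)$; then $m\ge e_1$. Moreover, if $m>e_1$, then for any $i\ge 2$, $e_i'=2^{i-1}e_1$; otherwise, if $m=e_1$, let $c_1=b^k-1$ and $c_i=a^{2^i-2}+b\,c_{i-1}^2$ for $i\ge 2$; then for any $i\ge 2$, $$e_i'=\min\left\{(2^i-1)e_1,\ v_P(c_i)\right\}.$$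
   Context: Let $\mathbb{F}_q$ be the finite field with $q=p^l$ elements, $p$ prime, $l\ge1$. Fix $a,b\in\mathbb{F}_q[x]$ with $b\neq 0$, and put $\Delta=a^2+4b$. The generalized Fibonacci sequence is $F_0=0$, $F_1=1$, $F_n=aF_{n-1}+bF_{n-2}$ for $n\ge 2$. Fix an irreducible polynomial $P\in\mathbb{F}_q[x]$ with $\gcd(b,P)=1$. For a non-constant $M\in\mathbb{F}_q[x]$ with $\gcd(b,M)=1$, the rank $\alpha(M)$ is the least positive integer $n$ with $F_n\equiv 0\pmod M$, and the period $\pi(M)$ is the least positive integer $n$ with $F_n\equiv 0$ and $F_{n+1}\equiv 1\pmod M$. For $i\ge 1$, $e_i$ denotes the $i$-th smallest positive integer $e$ such that $\alpha(P^e)\neq\alpha(P^{e+1})$ (if it exists), and $e_i'$ denotes the $i$-th smallest positive integer $e$ such that $\pi(P^e)\neq\pi(P^{e+1})$ (if it exists; all $e_i'$ exist when $a,b$ are not both in $\mathbb{F}_q$). For $g$ coprime to $P$, $\mathrm{ord}_P(g)$ is the multiplicative order of $g$ modulo $P$. For nonzero $g\in\mathbb{F}_q[x]$, $v_P(g)$ is the largest integer $n$ with $P^n\mid g$, and $v_P(0)=+\infty$. *)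

theory Defs
  imports
    "HOL-Computational_Algebra.Computational_Algebra"
    "HOL-Number_Theory.Cong"
    "HOL-Library.Extended_Nat"
begin

fun gfib :: "'a::comm_ring_1 \<Rightarrow> 'a \<Rightarrow> nat \<Rightarrow> 'a" where
  "gfib a b 0 = 0"
| "gfib a b (Suc 0) = 1"
| "gfib a b (Suc (Suc n)) = a * gfib a b (Suc n) + b * gfib a b n"

definition fib_discr :: "'a::comm_ring_1 \<Rightarrow> 'a \<Rightarrow> 'a" where
  "fib_discr a b = a ^ 2 + 4 * b"

text \<open>The next three minima are attained whenever \<open>M\<close> is non-constant over a finite field and
  coprime to \<open>b\<close> (respectively to \<open>g\<close>); they are unspecified otherwise.\<close>

definition fib_rank :: "'a::field poly \<Rightarrow> 'a poly \<Rightarrow> 'a poly \<Rightarrow> nat" where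
  "fib_rank a b M = (LEAST n. n > 0 \<and> [gfib a b n = 0] (mod M))"

definition fib_period :: "'a::field poly \<Rightarrow> 'a poly \<Rightarrow> 'a poly \<Rightarrow> nat" where
  "fib_period a b M =
     (LEAST n. n > 0 \<and> [gfib a b n = 0] (mod M) \<and> [gfib a b (n + 1) = 1] (mod M))"

definition poly_ord :: "'a::field poly \<Rightarrow> 'a poly \<Rightarrow> nat" where
  "poly_ord M g = (LEAST k. k > 0 \<and> [g ^ k = 1] (mod M))"

definition rank_jumps :: "'a::field poly \<Rightarrow> 'a poly \<Rightarrow> 'a poly \<Rightarrow> nat set" where
  "rank_jumps a b P = {e. e > 0 \<and> fib_rank a b (P ^ e) \<noteq> fib_rank a b (P ^ (e + 1))}"

definition period_jumps :: "'a::field poly \<Rightarrow> 'a poly \<Rightarrow> 'a poly \<Rightarrow> nat set" where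
  "period_jumps a b P = {e. e > 0 \<and> fib_period a b (P ^ e) \<noteq> fib_period a b (P ^ (e + 1))}"

text \<open>\<open>is_ith_smallest i S e\<close>: the \<open>i\<close>-th smallest element of \<open>S\<close> (counting from 1) exists
  and is \<open>e\<close>.\<close>

definition is_ith_smallest :: "nat \<Rightarrow> nat set \<Rightarrow> nat \<Rightarrow> bool" where
  "is_ith_smallest i S e \<longleftrightarrow> e \<in> S \<and> card {x \<in> S. x \<le> e} = i"

text \<open>For non-constant \<open>P\<close> the set of such \<open>n\<close> is bounded, so the maximum exists. The
  library's \<open>multiplicity\<close> is not available here: its sort constraints are not met by
  \<open>'a poly\<close> for an arbitrary field \<open>'a\<close>.\<close>

definition pval :: "'a::field poly \<Rightarrow> 'a poly \<Rightarrow> enat" where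
  "pval P g = (if g = 0 then \<infinity> else enat (GREATEST n. P ^ n dvd g))"

end

theory Submission
  imports Defs
begin

text \<open>
  Let \<open>t\<close> be a root of \<open>X\<^sup>2 - a X - b\<close>. In the basis \<open>1, t\<close> one has \<open>t\<^sup>n = G\<^sub>n + F\<^sub>n t\<close>
  with \<open>G\<^sub>n = F\<^bsub>n+1\<^esub> - a F\<^sub>n\<close>. So the period modulo \<open>M\<close> is the multiplicative order of \<open>t\<close>
  modulo \<open>M\<close>, and the rank is the least \<open>n > 0\<close> for which \<open>t\<^sup>n\<close> is scalar modulo \<open>M\<close>. The
  Frobenius map governs both. For a power \<open>q\<close> of \<open>p\<close>, raising \<open>t\<^sup>n = G\<^sub>n + F\<^sub>n t\<close> to the \<open>q\<close>-th
  power gives \<open>F\<^bsub>qn\<^esub> = F\<^sub>n\<^sup>q F\<^sub>q\<close> and \<open>G\<^bsub>qn\<^esub> = G\<^sub>n\<^sup>q + F\<^sub>n\<^sup>q G\<^sub>q\<close> (lemma \<open>gfib_mult_power_CHAR\<close>).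

  Let \<open>N\<close> be the period modulo \<open>P\<close> and let \<open>w\<^sub>i\<close> be the largest \<open>n\<close> such that \<open>P\<^sup>n\<close> divides
  \<open>t\<^bsup>N p^i\<^esup> - 1\<close>. It is finite because \<open>t\<close> has infinite order when \<open>a\<close> and \<open>b\<close> are not both
  constant, and \<open>w\<^bsub>i+1\<^esub> \<ge> p w\<^sub>i\<close>. The period modulo \<open>P\<^sup>e\<close> is \<open>N p\<^sup>i\<close> for the least \<open>i\<close> with
  \<open>e \<le> w\<^sub>i\<close>, so the period jumps are exactly the \<open>w\<^sub>i\<close>: \<open>e'\<^sub>i = w\<^bsub>i-1\<^esub>\<close> (\<open>period_jumps_eq\<close>).
  Likewise, if \<open>\<alpha>\<close> is the rank modulo \<open>P\<close>, then \<open>e\<^sub>1 = v\<^sub>P (F\<^sub>\<alpha>)\<close>, and \<open>e\<^sub>1\<close> exists iff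
  \<open>F\<^sub>\<alpha> \<noteq> 0\<close> (\<open>first_rank_jump_iff\<close>). It remains to compute \<open>w\<^sub>i\<close>.

  \<^item> In (a) and (b), \<open>v\<^sub>P (F\<^sub>N)\<close> exceeds \<open>w\<^sub>0\<close>, so \<open>w\<^sub>0 = v\<^sub>P (G\<^sub>N - 1)\<close>; the scalar part keeps
    dominating after Frobenius and \<open>w\<^sub>i = p\<^sup>i w\<^sub>0\<close> (\<open>level_geometric_of_rank\<close>).
  \<^item> In (c), \<open>F\<^sub>q\<close> is a power of an element prime to \<open>P\<close> whenever \<open>q\<close> is a power of \<open>p\<close>. Hence
    \<open>1, t\<^sup>q\<close> is still a basis modulo \<open>P\<close>, and both coordinates scale by \<open>q\<close>
    (\<open>level_geometric_of_unramified\<close>).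
  \<^item> In (d), put \<open>h = a / 2\<close> and \<open>D = h\<^sup>2 + b = \<Delta> / 4\<close>, so that \<open>(t - h)\<^sup>2 = D\<close>. Then
    \<open>F\<^sub>q = D\<^bsup>(q - 1) / 2\<^esup>\<close>, the rank is \<open>p\<close>, the period is \<open>p k\<close>, and with \<open>q = p\<^bsup>i+1\<^esup>\<close> the
    coordinates of \<open>t\<^bsup>kq\<^esup> - 1\<close> in the basis \<open>1, t - h\<close> are congruent to \<open>(h\<^sup>k - 1)\<^sup>q\<close> modulo \<open>D\<^sup>q\<close>
    and equal to \<open>F\<^sub>q\<close> times an element prime to \<open>P\<close>. The formula is the minimum of the two
    valuations (\<open>level_odd_ramified\<close>).
  \<^item> In (e), \<open>F\<^sub>q = a\<^bsup>q-1\<^esup>\<close>, the rank is \<open>2\<close> and the period is \<open>2 k\<close>. With \<open>q = 2\<^bsup>i+1\<^esup>\<close> the two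
    coordinates have valuations \<open>(q - 1) e\<^sub>1\<close> and \<open>v\<^sub>P (G\<^bsub>kq\<^esub> - 1)\<close>. Up to a power of \<open>b\<close>,
    \<open>G\<^bsub>kq\<^esub> - 1\<close> agrees with \<open>c\<^bsub>i+1\<^esub>\<close> modulo \<open>P\<^bsup>q e1\<^esup>\<close> (\<open>norm_sequence_cong\<close>), and a difference
    of that valuation does not affect the minimum.
\<close>

section \<open>Powers of a root of the characteristic polynomial\<close>

text \<open>The constant coordinate of \<open>t\<^sup>n\<close>. For positive \<open>n\<close> it is \<open>b F\<^bsub>n-1\<^esub>\<close>; the form below also
  gives the right value 1 at \<open>n = 0\<close>.\<close>
definition gfib0 :: "'a::comm_ring_1 \<Rightarrow> 'a \<Rightarrow> nat \<Rightarrow> 'a" where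
  "gfib0 a b n = gfib a b (Suc n) - a * gfib a b n"

lemma gfib0_0 [simp]: "gfib0 a b 0 = 1"
  by (simp add: gfib0_def)

lemma gfib0_Suc [simp]: "gfib0 a b (Suc n) = b * gfib a b n"
  by (simp add: gfib0_def)

lemma gfib_Suc: "gfib a b (Suc n) = gfib0 a b n + a * gfib a b n"
  by (simp add: gfib0_def)

declare gfib.simps(3) [simp del]

text \<open>Compare coordinates in \<open>t\<^bsup>m + n\<^esup> = t\<^sup>m t\<^sup>n\<close>. Each coordinate needs the other in the
  induction.\<close>
lemma gfib_add_aux:
  "gfib a b (m + n) = gfib a b m * gfib0 a b n + gfib0 a b m * gfib a b n + a * gfib a b m * gfib a b n \<and>
   gfib0 a b (m + n) = gfib0 a b m * gfib0 a b n + b * gfib a b m * gfib a b n"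
  by (induction m) (simp_all add: gfib_Suc algebra_simps)

lemmas gfib_add = gfib_add_aux [THEN conjunct1]
lemmas gfib0_add = gfib_add_aux [THEN conjunct2]

text \<open>The norm of \<open>x + y t\<close> is \<open>x\<^sup>2 + a x y - b y\<^sup>2\<close>, and the norm of \<open>t\<close> is \<open>- b\<close>.\<close>
lemma gfib_norm:
  "gfib0 a b n ^ 2 + a * gfib0 a b n * gfib a b n - b * gfib a b n ^ 2 = (- b) ^ n"
proof (induction n)
  case (Suc n)
  have "gfib0 a b (Suc n) ^ 2 + a * gfib0 a b (Suc n) * gfib a b (Suc n) - b * gfib a b (Suc n) ^ 2
      = - b * (gfib0 a b n ^ 2 + a * gfib0 a b n * gfib a b n - b * gfib a b n ^ 2)"
    by (simp add: gfib_Suc algebra_simps power2_eq_square)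
  then show ?case
    by (simp add: Suc.IH)
qed simp

definition fib_charpoly :: "'a::comm_ring_1 \<Rightarrow> 'a \<Rightarrow> 'a poly" where
  "fib_charpoly a b = [:- b, - a, 1:]"

text \<open>Coordinates are unique: congruences modulo the characteristic polynomial between linear
  polynomials are equalities. This turns computations with \<open>t\<close> into computations in \<open>R[X]\<close>.\<close>
lemma fib_charpoly_dvd_linear_iff:
  fixes a b x y :: "'a::idom"
  shows "fib_charpoly a b dvd [:x, y:] \<longleftrightarrow> x = 0 \<and> y = 0"
proof
  assume *: "fib_charpoly a b dvd [:x, y:]"
  show "x = 0 \<and> y = 0"
  proof (rule ccontr)
    assume "\<not> (x = 0 \<and> y = 0)"
    then have "degree (fib_charpoly a b) \<le> degree [:x, y:]"
      using * by (intro dvd_imp_degree_le) auto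
    then show False
      by (simp add: fib_charpoly_def split: if_splits)
  qed
qed simp

lemma fib_charpoly_dvd_power_diff:
  "fib_charpoly a b dvd [:0, 1:] ^ n - [:gfib0 a b n, gfib a b n:]"
proof (induction n)
  case 0
  then show ?case by (simp add: one_pCons)
next
  case (Suc n)
  have "[:0, 1:] ^ Suc n - [:gfib0 a b (Suc n), gfib a b (Suc n):]
      = [:0, 1:] * ([:0, 1:] ^ n - [:gfib0 a b n, gfib a b n:]) + [:gfib a b n:] * fib_charpoly a b"
    by (simp add: gfib_Suc fib_charpoly_def algebra_simps)
  then show ?case
    using Suc by (metis dvd_add dvd_mult dvd_triv_right)
qed

lemma dvd_power_diff_power:
  fixes d x y :: "'a::comm_ring_1"
  assumes "d dvd x - y"
  shows "d dvd x ^ n - y ^ n"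
proof (induction n)
  case (Suc n)
  have "x ^ Suc n - y ^ Suc n = x * (x ^ n - y ^ n) + (x - y) * y ^ n"
    by (simp add: algebra_simps)
  then show ?case
    using Suc assms by (metis dvd_add dvd_mult dvd_mult2)
qed simp

text \<open>Frobenius applied to \<open>t\<^sup>n = G\<^sub>n + F\<^sub>n t\<close>, followed by \<open>t\<^sup>q = G\<^sub>q + F\<^sub>q t\<close>.\<close>
lemma gfib_mult_power_CHAR:
  fixes a b :: "'a::idom" and i n :: nat
  assumes CHAR: "prime CHAR('a)"
  defines "q \<equiv> CHAR('a) ^ i"
  shows "gfib a b (q * n) = gfib a b n ^ q * gfib a b q"
    and "gfib0 a b (q * n) = gfib0 a b n ^ q + gfib a b n ^ q * gfib0 a b q"
proof -
  let ?X = "[:0, 1:] :: 'a poly" and ?F = "gfib a b" and ?G = "gfib0 a b"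
  let ?Q = "fib_charpoly a b"
  have 1: "?Q dvd ?X ^ (q * n) - [:?G n, ?F n:] ^ q"
    using dvd_power_diff_power[OF fib_charpoly_dvd_power_diff[of a b n], of q]
    by (simp only: power_mult[symmetric] mult.commute)
  have "[:?G n, ?F n:] ^ q = ([:?G n:] + [:?F n:] * ?X) ^ q"
    by simp
  also have "\<dots> = [:?G n:] ^ q + ([:?F n:] * ?X) ^ q"
    by (rule freshmans_dream') (simp_all add: CHAR q_def)
  also have "\<dots> = [:?G n ^ q:] + [:?F n ^ q:] * ?X ^ q"
    by (simp only: power_mult_distrib poly_const_pow)
  finally have 2: "[:?G n, ?F n:] ^ q = [:?G n ^ q:] + [:?F n ^ q:] * ?X ^ q" .
  have "[:?G (q * n) - (?G n ^ q + ?F n ^ q * ?G q), ?F (q * n) - ?F n ^ q * ?F q:]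
      = (?X ^ (q * n) - [:?G n, ?F n:] ^ q) - (?X ^ (q * n) - [:?G (q * n), ?F (q * n):])
        + [:?F n ^ q:] * (?X ^ q - [:?G q, ?F q:])"
    unfolding 2 by (simp add: algebra_simps)
  also have "?Q dvd \<dots>"
    by (intro dvd_add dvd_diff dvd_mult 1 fib_charpoly_dvd_power_diff)
  finally show "?F (q * n) = ?F n ^ q * ?F q" "?G (q * n) = ?G n ^ q + ?F n ^ q * ?G q"
    unfolding fib_charpoly_dvd_linear_iff by simp_all
qed

text \<open>Since \<open>(t - h)\<^sup>2 = D\<close>, the odd power \<open>(t - h)\<^sup>q\<close> is \<open>D\<^sup>j (t - h)\<close>; by Frobenius it is also
  \<open>t\<^sup>q - h\<^sup>q\<close>.\<close>
lemma gfib_power_CHAR_odd: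
  fixes a b h :: "'a::idom" and i j :: nat
  assumes CHAR: "prime CHAR('a)" and a: "a = 2 * h" and q: "CHAR('a) ^ i = Suc (2 * j)"
  defines "D \<equiv> h ^ 2 + b" and "q \<equiv> CHAR('a) ^ i"
  shows "gfib a b q = D ^ j"
    and "gfib0 a b q + h * gfib a b q = h ^ q"
proof -
  let ?X = "[:0, 1:] :: 'a poly" and ?F = "gfib a b" and ?G = "gfib0 a b"
  let ?Q = "fib_charpoly a b"
  have sq: "[:- h, 1:] ^ 2 = ?Q + [:D:]"
    by (simp add: fib_charpoly_def D_def a power2_eq_square algebra_simps)
  have "?Q dvd ([:- h, 1:] ^ 2) ^ j - [:D:] ^ j"
    by (rule dvd_power_diff_power) (simp add: sq)
  then have "?Q dvd [:- h, 1:] * (([:- h, 1:] ^ 2) ^ j - [:D ^ j:])"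
    unfolding poly_const_pow by (rule dvd_mult)
  moreover have "[:- h, 1:] ^ q = [:- h, 1:] * ([:- h, 1:] ^ 2) ^ j"
    by (simp only: q_def q power_Suc power_mult)
  ultimately have 1: "?Q dvd [:- h, 1:] ^ q - [:- h, 1:] * [:D ^ j:]"
    by (simp only: right_diff_distrib)
  have "[:- h, 1:] ^ q = ([:- h:] + ?X) ^ q"
    by simp
  also have "\<dots> = [:- (h ^ q):] + ?X ^ q"
    by (subst freshmans_dream'[where n = i])
       (use CHAR in \<open>simp_all add: q_def q poly_const_pow\<close>)
  finally have 2: "[:- h, 1:] ^ q = [:- (h ^ q):] + ?X ^ q" .
  have "[:?G q - h ^ q + h * D ^ j, ?F q - D ^ j:]
     = ([:- h, 1:] ^ q - [:- h, 1:] * [:D ^ j:]) - (?X ^ q - [:?G q, ?F q:])"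
    unfolding 2 by (simp add: algebra_simps)
  also have "?Q dvd \<dots>"
    by (intro dvd_diff 1 fib_charpoly_dvd_power_diff)
  finally show "?F q = D ^ j" and "?G q + h * ?F q = h ^ q"
    unfolding fib_charpoly_dvd_linear_iff by (simp_all add: algebra_simps)
qed

lemma gfib_double_CHAR_2:
  fixes a b :: "'a::idom"
  assumes "CHAR('a) = 2"
  shows "gfib a b (2 * n) = a * gfib a b n ^ 2"
    and "gfib0 a b (2 * n) = gfib0 a b n ^ 2 + b * gfib a b n ^ 2"
proof -
  have "prime CHAR('a)"
    by (simp add: assms)
  from gfib_mult_power_CHAR[OF this, of a b 1 n]
  show "gfib a b (2 * n) = a * gfib a b n ^ 2"
    and "gfib0 a b (2 * n) = gfib0 a b n ^ 2 + b * gfib a b n ^ 2"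
    by (simp_all add: assms gfib_Suc eval_nat_numeral mult_ac)
qed

lemma gfib_power_2_CHAR_2:
  fixes a b :: "'a::idom"
  assumes "CHAR('a) = 2"
  shows "gfib a b (2 ^ i) = a ^ (2 ^ i - 1)"
proof (induction i)
  case (Suc i)
  have e: "(2 ^ Suc i - 1 :: nat) = Suc ((2 ^ i - 1) * 2)"
    using one_le_power[of "2 :: nat" i] unfolding power_Suc by linarith
  have "gfib a b (2 ^ Suc i) = a * (a ^ (2 ^ i - 1)) ^ 2"
    by (simp only: power_Suc gfib_double_CHAR_2[OF assms] Suc.IH)
  also have "\<dots> = a ^ (2 ^ Suc i - 1)"
    unfolding e by (simp only: power_Suc power_mult)
  finally show ?case .
qed simp

text \<open>The coordinates of \<open>t\<^sup>n\<close> in the basis \<open>1, t - h\<close> are \<open>G\<^sub>n + h F\<^sub>n\<close> and \<open>F\<^sub>n\<close>. Since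
  \<open>t - h\<close> has square \<open>D = h\<^sup>2 + b\<close>, only even powers of it enter the first one.\<close>
lemma gfib0_plus_half:
  fixes a b h :: "'a::comm_ring_1"
  assumes "a = 2 * h"
  shows "(h ^ 2 + b) dvd (gfib0 a b n + h * gfib a b n - h ^ n)"
proof (induction n)
  case (Suc n)
  have "gfib0 a b (Suc n) + h * gfib a b (Suc n) - h ^ Suc n
     = h * (gfib0 a b n + h * gfib a b n - h ^ n) + (h ^ 2 + b) * gfib a b n"
    by (simp add: gfib_Suc assms algebra_simps power2_eq_square)
  then show ?case
    using Suc by (metis dvd_add dvd_mult dvd_triv_left)
qed simp

section \<open>Least positive elements, ordered jumps and residues\<close>

text \<open>Ranks, periods and orders are all least positive elements of a set of naturals that is the
  trace of a subgroup of the integers; here the subgroup condition is expressed without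
  subtraction.\<close>

lemma Least_pos_dvd_iff:
  fixes A :: "nat \<Rightarrow> bool"
  assumes closed: "\<And>m n. A m \<Longrightarrow> A (m + n) \<longleftrightarrow> A n" and N: "A N" "N > 0"
  defines "d \<equiv> LEAST n. n > 0 \<and> A n"
  shows "d > 0" and "A n \<longleftrightarrow> d dvd n"
proof -
  have "d > 0 \<and> A d"
    unfolding d_def by (rule LeastI[of _ N]) (use N in simp)
  then show d: "d > 0" by simp
  have mult: "A (k * d)" for k
    using closed[of d] closed[of N 0] N \<open>d > 0 \<and> A d\<close> by (induction k) simp_all
  have "A n \<longleftrightarrow> A (n div d * d + n mod d)" by simp
  also have "\<dots> \<longleftrightarrow> A (n mod d)"
    using closed mult by blast
  also have "\<dots> \<longleftrightarrow> n mod d = 0"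
    using not_less_Least[of "n mod d" "\<lambda>n. n > 0 \<and> A n"] mod_less_divisor[OF d, of n] mult[of 0]
    unfolding d_def[symmetric] by (cases "n mod d = 0") auto
  finally show "A n \<longleftrightarrow> d dvd n"
    by (simp add: mod_eq_0_iff_dvd)
qed

lemma is_ith_smallest_1_iff:
  "is_ith_smallest 1 S e \<longleftrightarrow> e \<in> S \<and> (\<forall>x\<in>S. e \<le> x)"
proof
  assume *: "is_ith_smallest 1 S e"
  then obtain y where "{x \<in> S. x \<le> e} = {y}" "e \<in> S"
    by (metis is_ith_smallest_def card_1_singletonE)
  then show "e \<in> S \<and> (\<forall>x\<in>S. e \<le> x)"
    by (metis (mono_tags, lifting) mem_Collect_eq nle_le order_refl singletonD)
next
  assume *: "e \<in> S \<and> (\<forall>x\<in>S. e \<le> x)"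
  then have "{x \<in> S. x \<le> e} = {e}" by force
  then show "is_ith_smallest 1 S e"
    using * by (simp add: is_ith_smallest_def)
qed

lemma is_ith_smallest_range:
  assumes "strict_mono w" "i \<ge> 1"
  shows "is_ith_smallest i (range w) (w (i - 1))"
proof -
  have "{x \<in> range w. x \<le> w (i - 1)} = w ` {..i - 1}"
    using strict_mono_less_eq[OF assms(1)] by auto
  moreover have "inj_on w {..i - 1}"
    using assms(1) strict_mono_on_imp_inj_on by (metis inj_on_subset strict_mono_imp_inj_on subset_UNIV)
  ultimately show ?thesis
    using assms(2) by (simp add: is_ith_smallest_def card_image)
qed

text \<open>Translating by 1 permutes the field and adds its cardinality to the sum of all elements, so
  that cardinality vanishes in the field.\<close>
lemma CHAR_eq_of_card:
  fixes p l :: nat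
  assumes "prime p" "card (UNIV :: 'a::{field,finite} set) = p ^ l"
  shows "CHAR('a) = p"
proof -
  have "(\<Sum>x\<in>(UNIV :: 'a set). x) = (\<Sum>x\<in>(UNIV :: 'a set). x + 1)"
    by (rule sum.reindex_bij_witness[of _ "\<lambda>x. x + 1" "\<lambda>x. x - 1"]) auto
  then have "of_nat (card (UNIV :: 'a set)) = (0 :: 'a)"
    by (simp add: sum.distrib)
  then have "of_nat p = (0 :: 'a)"
    by (simp add: assms(2))
  then have "CHAR('a) dvd p"
    by (simp add: of_nat_eq_0_iff_char_dvd)
  then show ?thesis
    using assms(1) CHAR_not_1'[where ?'a = 'a] by (auto simp: prime_nat_iff)
qed

text \<open>This bounds the number of residues modulo a polynomial: they have no coefficients from its
  degree on.\<close>
lemma finite_coeff_zero_from: "finite {f :: 'a::{zero,finite} poly. \<forall>i\<ge>n. coeff f i = 0}"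
proof (induction n)
  case 0
  have "{f :: 'a poly. \<forall>i\<ge>0. coeff f i = 0} = {0}"
    by (auto simp: poly_eq_iff)
  then show ?case by simp
next
  case (Suc n)
  let ?S = "\<lambda>n. {f :: 'a poly. \<forall>i\<ge>n. coeff f i = 0}"
  have "?S (Suc n) \<subseteq> (\<lambda>(c, f). pCons c f) ` (UNIV \<times> ?S n)"
  proof
    fix g assume "g \<in> ?S (Suc n)"
    then show "g \<in> (\<lambda>(c, f). pCons c f) ` (UNIV \<times> ?S n)"
      by (cases g) (force simp: coeff_pCons split: nat.splits)
  qed
  then show ?case
    using Suc by (meson finite_SigmaI finite_UNIV finite_imageI finite_subset finite)
qed

text \<open>Pigeonhole on the pairs of residues of \<open>f\<close> and \<open>g\<close>.\<close>
lemma ex_recurrent_mod: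
  fixes P :: "'a::{field,finite} poly" and f g :: "nat \<Rightarrow> 'a poly"
  assumes "P \<noteq> 0"
  obtains m d where "d > 0" "P dvd f (m + d) - f m" "P dvd g (m + d) - g m"
proof -
  let ?S = "{f :: 'a poly. \<forall>i\<ge>degree P. coeff f i = 0}"
  let ?r = "\<lambda>n. (f n mod P, g n mod P)"
  have "h mod P \<in> ?S" for h
    using degree_mod_less[OF assms, of h] by (auto intro: coeff_eq_0)
  then have "range ?r \<subseteq> ?S \<times> ?S" by blast
  then have "finite (range ?r)"
    using finite_coeff_zero_from[where ?'a = 'a] by (meson finite_SigmaI finite_subset)
  then have "\<not> inj ?r"
    using infinite_UNIV_nat finite_imageD by blast
  then obtain m n where "m < n" "?r n = ?r m"
    by (metis (lifting) injI linorder_neq_iff)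
  then have "P dvd f n - f m" "P dvd g n - g m" "n = m + (n - m)" "n - m > 0"
    by (auto simp: mod_eq_dvd_iff)
  then show ?thesis
    using that[of "n - m" m] by simp
qed

section \<open>The valuation at an irreducible polynomial\<close>

lemma dvd_cong_diff:
  fixes d x y :: "'a::comm_ring_1"
  assumes "d dvd x - y"
  shows "d dvd x \<longleftrightarrow> d dvd y"
  by (metis assms dvd_add_right_iff diff_add_cancel)

text \<open>Valuations are compared through the powers of \<open>P\<close> that divide, so equality in the extended
  naturals is tested on finite lower bounds.\<close>
lemma enat_le_iff_imp_eq:
  assumes "\<And>n. enat n \<le> x \<longleftrightarrow> enat n \<le> y"
  shows "x = y"
proof (cases x y rule: linorder_cases)
  case less
  then obtain k where "x = enat k"
    by (cases x) auto
  then show ?thesis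
    using less assms[of "Suc k"] by (simp add: Suc_ile_eq)
next
  case greater
  then obtain k where "y = enat k"
    by (cases y) auto
  then show ?thesis
    using greater assms[of "Suc k"] by (simp add: Suc_ile_eq)
qed

lemma pval_ge_iff:
  assumes P: "prime_elem P"
  shows "enat n \<le> pval P g \<longleftrightarrow> P ^ n dvd g"
proof (cases "g = 0")
  case False
  have deg: "degree P > 0"
    using P by (metis is_unit_iff_degree prime_elem_def gr0I)
  have bound: "k \<le> degree g" if "P ^ k dvd g" for k
  proof -
    have "k * degree P \<le> degree g"
      using dvd_imp_degree_le[OF that False] P by (simp add: degree_power_eq prime_elem_def)
    then show ?thesis
      using deg mult_le_mono2[of 1 "degree P" k] by linarith
  qed
  let ?G = "GREATEST k. P ^ k dvd g"
  have "P ^ ?G dvd g"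
    by (rule GreatestI_nat[where k = 0 and b = "degree g"]) (simp_all add: bound)
  moreover have "k \<le> ?G" if "P ^ k dvd g" for k
    by (rule Greatest_le_nat[where b = "degree g"]) (simp_all add: that bound)
  ultimately show ?thesis
    using False by (auto simp: pval_def intro: power_le_dvd)
qed (simp add: pval_def)

lemma pval_eq_infinity_iff: "pval P g = \<infinity> \<longleftrightarrow> g = 0"
  by (simp add: pval_def)

lemma pval_eq_0_iff:
  assumes "prime_elem P"
  shows "pval P g = 0 \<longleftrightarrow> \<not> P dvd g"
  using pval_ge_iff[OF assms, of 1 g] by (cases "pval P g") (auto simp: zero_enat_def)

lemma pval_mult:
  assumes P: "prime_elem P"
  shows "pval P (f * g) = pval P f + pval P g"
proof (cases "f = 0 \<or> g = 0")
  case False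
  then obtain r s where rs: "pval P f = enat r" "pval P g = enat s"
    by (metis pval_eq_infinity_iff not_infinity_eq)
  note ge = pval_ge_iff[OF P, symmetric]
  have "P ^ (r + s) dvd f * g"
    unfolding power_add by (rule mult_dvd_mono) (simp_all add: ge rs)
  moreover have "\<not> P ^ Suc (r + s) dvd f * g"
    using prime_elem_power_dvd_cases[of P "Suc (r + s)" f g "Suc r" "Suc s"] P
    by (auto simp del: power_Suc simp: ge rs)
  moreover obtain t where "pval P (f * g) = enat t"
    by (metis False pval_eq_infinity_iff not_infinity_eq mult_eq_0_iff)
  ultimately show ?thesis
    by (auto simp del: power_Suc simp: ge rs)
qed (auto simp: pval_def)

lemma pval_power:
  assumes P: "prime_elem P"
  shows "pval P (f ^ n) = enat n * pval P f"
proof (induction n)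
  case 0
  have "\<not> P dvd 1"
    using P by (simp add: prime_elem_def)
  then show ?case
    using pval_eq_0_iff[OF P, of 1] by (simp add: zero_enat_def[symmetric])
next
  case (Suc n)
  then show ?case
    by (simp add: pval_mult[OF P] eSuc_enat[symmetric] mult_eSuc)
qed

lemma power_dvd_cancel_left:
  fixes P u x :: "'a::field poly"
  assumes "prime_elem P" "\<not> P dvd u"
  shows "P ^ n dvd u * x \<longleftrightarrow> P ^ n dvd x"
  using assms pval_eq_0_iff[OF assms(1), of u] by (simp add: pval_ge_iff[symmetric] pval_mult)

lemma power_CHAR_minus_one:
  fixes x :: "'a::comm_ring_1"
  assumes "prime CHAR('a)"
  shows "x ^ (CHAR('a) ^ i) - 1 = (x - 1) ^ (CHAR('a) ^ i)"
  using freshmans_dream'[OF assms refl, of "x - 1" 1 i] by simp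

lemma pval_add_eq_left:
  assumes P: "prime_elem P" and "pval P f < pval P g"
  shows "pval P (f + g) = pval P f"
proof -
  obtain r where r: "pval P f = enat r"
    using assms(2) by (cases "pval P f") auto
  then have "enat (Suc r) \<le> pval P g"
    using assms(2) by (simp add: Suc_ile_eq)
  then have g: "P ^ Suc r dvd g"
    by (simp only: pval_ge_iff[OF P])
  have f: "P ^ n dvd f \<longleftrightarrow> n \<le> r" for n
    by (simp add: r flip: pval_ge_iff[OF P])
  show ?thesis
  proof (rule enat_le_iff_imp_eq)
    fix n
    have small: "P ^ n dvd f + g \<longleftrightarrow> P ^ n dvd f" if "n \<le> Suc r" for n
      using power_le_dvd[OF g that] by (simp add: dvd_add_left_iff)
    have "P ^ n dvd f + g \<longleftrightarrow> P ^ n dvd f"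
    proof (cases "n \<le> Suc r")
      case False
      then have "\<not> P ^ n dvd f + g"
        using small[of "Suc r"] f[of "Suc r"] power_le_dvd[of P n "f + g" "Suc r"] by auto
      then show ?thesis
        using False f by simp
    qed (rule small)
    then show "enat n \<le> pval P (f + g) \<longleftrightarrow> enat n \<le> pval P f"
      by (simp add: pval_ge_iff[OF P])
  qed
qed

section \<open>Periods modulo powers of an irreducible polynomial\<close>

locale fib_mod_prime =
  fixes a b P :: "'a::{field,finite} poly" and p :: nat
  assumes char: "CHAR('a) = p"
    and irreducible: "irreducible P"
    and coprime: "coprime b P"
    and nonconstant: "\<not> (degree a = 0 \<and> degree b = 0)"
begin

abbreviation "F \<equiv> gfib a b"
abbreviation "G \<equiv> gfib0 a b"

lemma prime_p: "prime p"
  using prime_CHAR_semidom[OF finite_imp_CHAR_pos[where ?'a = 'a, OF finite]] by (simp add: char)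

lemma prime_p': "prime CHAR('a poly)"
  using prime_p by (simp add: char)

lemma prime_P: "prime_elem P"
  by (rule field_poly_irreducible_imp_prime[OF irreducible])

lemma P_nonzero: "P \<noteq> 0"
  using prime_P by auto

lemma not_P_dvd_1: "\<not> P dvd 1"
  using prime_P by (simp add: prime_elem_def)

lemma not_P_dvd_b: "\<not> P dvd b"
  using coprime not_P_dvd_1 by (meson coprime_common_divisor dvd_refl)

lemma gfib_mult_power_p:
  shows "F (n * p ^ i) = F n ^ (p ^ i) * F (p ^ i)"
    and "G (n * p ^ i) = G n ^ (p ^ i) + F n ^ (p ^ i) * G (p ^ i)"
  using gfib_mult_power_CHAR[OF prime_p', of a b i n] by (simp_all add: mult.commute char)

lemma gfib0_mult_power_p_minus_1:
  "G (n * p ^ i) - 1 = (G n - 1) ^ (p ^ i) + F n ^ (p ^ i) * G (p ^ i)"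
  using power_CHAR_minus_one[OF prime_p', of "G n" i] by (simp add: gfib_mult_power_p char algebra_simps)

text \<open>The norm \<open>(- b)\<^sup>n\<close> is prime to \<open>P\<close>, so the two coordinates of \<open>t\<^sup>n\<close> are not both divisible
  by \<open>P\<close>.\<close>
lemma not_P_dvd_gfib0:
  assumes "P dvd F n"
  shows "\<not> P dvd G n"
proof
  assume "P dvd G n"
  then have "P dvd G n ^ 2 + a * G n * F n - b * F n ^ 2"
    using assms by (simp add: power2_eq_square)
  then have "P dvd (- b) ^ n"
    by (simp only: gfib_norm)
  then show False
    using prime_elem_dvd_power[OF prime_P] not_P_dvd_b by (metis dvd_minus_iff)
qed

text \<open>The condition \<open>t\<^sup>n = 1\<close> modulo \<open>M\<close> in coordinates.\<close>
definition is_period :: "'a poly \<Rightarrow> nat \<Rightarrow> bool" where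
  "is_period M n \<longleftrightarrow> M dvd F n \<and> M dvd G n - 1"

lemma fib_period_eq: "fib_period a b M = (LEAST n. n > 0 \<and> is_period M n)"
proof -
  have "[F n = 0] (mod M) \<and> [F (n + 1) = 1] (mod M) \<longleftrightarrow> is_period M n" for n
  proof (cases "M dvd F n")
    case True
    then have "M dvd F (Suc n) - 1 \<longleftrightarrow> M dvd G n - 1"
      by (intro dvd_cong_diff) (simp add: gfib_Suc)
    then show ?thesis
      using True by (simp add: is_period_def cong_0_iff cong_iff_dvd_diff)
  qed (simp add: is_period_def cong_0_iff)
  then show ?thesis
    by (simp add: fib_period_def)
qed

lemma is_period_add:
  assumes "is_period M m"
  shows "is_period M (m + n) \<longleftrightarrow> is_period M n"
proof -
  have *: "M dvd F m" "M dvd G m - 1"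
    using assms by (simp_all add: is_period_def)
  have "F (m + n) - F n = F m * (G n + a * F n) + (G m - 1) * F n"
    by (simp add: gfib_add algebra_simps)
  then have "M dvd F (m + n) - F n"
    using * by simp
  moreover have "(G (m + n) - 1) - (G n - 1) = F m * (b * F n) + (G m - 1) * G n"
    by (simp add: gfib0_add algebra_simps)
  then have "M dvd (G (m + n) - 1) - (G n - 1)"
    using * by (metis dvd_add dvd_mult2)
  ultimately show ?thesis
    by (simp only: is_period_def dvd_cong_diff)
qed

text \<open>Two powers of \<open>t\<close> agree modulo \<open>P\<close>, and \<open>t\<close> can be cancelled because \<open>b\<close> is invertible
  modulo \<open>P\<close>.\<close>
lemma ex_period_mod_P: "\<exists>n>0. is_period P n"
proof -
  obtain m d where d: "d > 0" and "P dvd F (m + d) - F m" "P dvd G (m + d) - G m"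
    by (rule ex_recurrent_mod[OF P_nonzero])
  then have "P dvd F d \<and> P dvd G d - 1"
  proof (induction m)
    case (Suc m)
    have "P dvd b * (F (m + d) - F m)"
      using Suc.prems by (simp add: right_diff_distrib)
    then have F: "P dvd F (m + d) - F m"
      using power_dvd_cancel_left[OF prime_P not_P_dvd_b, of 1] by simp
    have "F (Suc m + d) - F (Suc m) - a * (F (m + d) - F m) = G (m + d) - G m"
      by (simp add: gfib_Suc algebra_simps)
    then have "P dvd G (m + d) - G m"
      using F Suc.prems by (metis dvd_diff dvd_mult)
    then show ?case
      using Suc.IH d F by blast
  qed simp
  then show ?thesis
    using d by (auto simp: is_period_def)
qed

text \<open>If \<open>t\<^sup>n = 1\<close> then \<open>b\<close> is a unit, hence constant, so \<open>a\<close> is not constant. But then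
  \<open>a F\<^sub>j\<close> dominates \<open>b F\<^bsub>j - 1\<^esub>\<close> in degree, and no \<open>F\<^sub>n\<close> with \<open>n > 0\<close> vanishes.\<close>
lemma gfib_infinite_order:
  assumes "n > 0"
  shows "\<not> (F n = 0 \<and> G n = 1)"
proof
  assume *: "F n = 0 \<and> G n = 1"
  obtain k where n: "n = Suc k"
    using assms gr0_implies_Suc by blast
  have "b dvd 1"
    using * n by (metis dvd_triv_left gfib0_Suc)
  moreover from this have "b \<noteq> 0"
    by auto
  ultimately have b: "degree b = 0" "b \<noteq> 0"
    using is_unit_iff_degree[of b] by simp_all
  then have a: "degree a > 0" "a \<noteq> 0"
    using nonconstant by auto
  have "F (Suc j) \<noteq> 0 \<and> degree (F j) \<le> degree (F (Suc j))" for j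
  proof (induction j)
    case (Suc j)
    have "degree (b * F j) < degree (a * F (Suc j))"
      using Suc a b degree_mult_le[of b "F j"] by (simp add: degree_mult_eq)
    then have "degree (a * F (Suc j) + b * F j) = degree (a * F (Suc j))"
      by (rule degree_add_eq_left)
    then have "degree (F (Suc (Suc j))) = degree (a * F (Suc j))"
      by (simp add: gfib.simps(3))
    then show ?case
      using Suc a by (auto simp: degree_mult_eq)
  qed simp
  then show False
    using * n by blast
qed

abbreviation "N0 \<equiv> fib_period a b P"

lemma period_pos: "N0 > 0"
  and is_period_P_iff: "is_period P n \<longleftrightarrow> N0 dvd n"
proof -
  obtain N where N: "is_period P N" "N > 0"
    using ex_period_mod_P by blast
  show "N0 > 0"
    unfolding fib_period_eq by (rule Least_pos_dvd_iff(1)[OF is_period_add N])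
  show "is_period P n \<longleftrightarrow> N0 dvd n"
    unfolding fib_period_eq by (rule Least_pos_dvd_iff(2)[OF is_period_add N])
qed

text \<open>The largest \<open>n\<close> with \<open>t\<^bsup>N0 p^i\<^esup> = 1\<close> modulo \<open>P\<^sup>n\<close>, as the smaller valuation of the two
  coordinates of \<open>t\<^bsup>N0 p^i\<^esup> - 1\<close>. The minimum is finite because \<open>t\<close> has infinite order.\<close>
definition level :: "nat \<Rightarrow> nat" where
  "level i = the_enat (min (pval P (F (N0 * p ^ i))) (pval P (G (N0 * p ^ i) - 1)))"

lemma enat_level: "enat (level i) = min (pval P (F (N0 * p ^ i))) (pval P (G (N0 * p ^ i) - 1))"
proof -
  have "N0 * p ^ i > 0"
    using period_pos prime_gt_0_nat[OF prime_p] by simp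
  then have "min (pval P (F (N0 * p ^ i))) (pval P (G (N0 * p ^ i) - 1)) \<noteq> \<infinity>"
    using gfib_infinite_order[of "N0 * p ^ i"] pval_eq_infinity_iff[of P "F (N0 * p ^ i)"]
      pval_eq_infinity_iff[of P "G (N0 * p ^ i) - 1"]
    by (auto simp: min_def split: if_splits)
  then show ?thesis
    by (auto simp: level_def)
qed

lemma le_level_iff: "n \<le> level i \<longleftrightarrow> is_period (P ^ n) (N0 * p ^ i)"
proof -
  have "n \<le> level i \<longleftrightarrow> enat n \<le> min (pval P (F (N0 * p ^ i))) (pval P (G (N0 * p ^ i) - 1))"
    by (simp flip: enat_level)
  also have "\<dots> \<longleftrightarrow> is_period (P ^ n) (N0 * p ^ i)"
    by (simp add: pval_ge_iff[OF prime_P] is_period_def)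
  finally show ?thesis .
qed

lemma level_pos: "level i > 0"
proof -
  have "1 \<le> level i"
    unfolding le_level_iff by (simp add: is_period_P_iff)
  then show ?thesis by simp
qed

text \<open>If \<open>P\<^sup>n\<close> divides \<open>u = t\<^sup>m - 1\<close>, then \<open>P\<^bsup>np\<^esup>\<close> divides \<open>u\<^sup>p = t\<^bsup>mp\<^esup> - 1\<close>.\<close>
lemma level_Suc_ge: "level i * p \<le> level (Suc i)"
proof -
  let ?n = "N0 * p ^ i" and ?e = "level i"
  have "is_period (P ^ ?e) ?n"
    by (rule iffD1[OF le_level_iff order_refl])
  then have "(P ^ ?e) ^ p dvd F ?n ^ p" "(P ^ ?e) ^ p dvd (G ?n - 1) ^ p"
    by (simp_all add: is_period_def dvd_power_same)
  then have "is_period (P ^ (?e * p)) (?n * p ^ 1)"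
    unfolding is_period_def gfib0_mult_power_p_minus_1[of ?n 1] gfib_mult_power_p(1)[of ?n 1]
    by (simp add: power_mult)
  then show ?thesis
    by (simp add: le_level_iff mult_ac)
qed

lemma strict_mono_level: "strict_mono level"
proof (subst strict_mono_Suc_iff, rule allI)
  fix i
  have "level i * 1 < level i * p"
    using level_pos[of i] prime_gt_1_nat[OF prime_p] by (intro mult_strict_left_mono)
  then show "level i < level (Suc i)"
    using level_Suc_ge[of i] by linarith
qed

text \<open>The period modulo \<open>P\<^sup>e\<close> is a multiple of the period modulo \<open>P\<close> and divides some \<open>N0 p\<^sup>i\<close>,
  so it is itself of the form \<open>N0 p\<^sup>j\<close>.\<close>
lemma fib_period_power:
  assumes "e > 0"
  shows "fib_period a b (P ^ e) = N0 * p ^ (LEAST i. e \<le> level i)"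
proof -
  let ?i = "LEAST i. e \<le> level i"
  have "e \<le> level e"
    by (rule strict_mono_imp_increasing[OF strict_mono_level])
  then have i: "is_period (P ^ e) (N0 * p ^ ?i)"
    unfolding le_level_iff[symmetric] by (rule LeastI)
  define d where "d = fib_period a b (P ^ e)"
  have pos: "N0 * p ^ ?i > 0"
    using period_pos prime_gt_0_nat[OF prime_p] by simp
  have d: "is_period (P ^ e) n \<longleftrightarrow> d dvd n" for n
    unfolding d_def fib_period_eq by (rule Least_pos_dvd_iff(2)[OF is_period_add i pos])
  have "is_period (P ^ e) d"
    by (simp add: d)
  moreover have "P dvd P ^ e"
    using assms by (simp add: dvd_power)
  ultimately have "is_period P d"
    unfolding is_period_def using dvd_trans by blast
  then obtain c where c: "d = N0 * c"
    unfolding is_period_P_iff by blast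
  have "c dvd p ^ ?i"
    using i period_pos unfolding d c by simp
  then obtain j where j: "j \<le> ?i" "c = p ^ j"
    using divides_primepow_nat[OF prime_p] by blast
  have "e \<le> level j"
    unfolding le_level_iff d c j(2) by simp
  then have "?i \<le> j"
    by (rule Least_le)
  then show ?thesis
    using j c by (simp add: d_def)
qed

text \<open>The least \<open>i\<close> with \<open>e \<le> level i\<close> changes between \<open>e\<close> and \<open>e + 1\<close> exactly when \<open>e\<close> is a level.\<close>
lemma period_jumps_eq: "period_jumps a b P = range level"
proof -
  have inc: "\<exists>i. e \<le> level i" for e
    by (rule exI, rule strict_mono_imp_increasing[OF strict_mono_level])
  have inj: "N0 * p ^ i = N0 * p ^ j \<longleftrightarrow> i = j" for i j
    using period_pos prime_gt_1_nat[OF prime_p] by simp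
  have "(LEAST i. e \<le> level i) \<noteq> (LEAST i. e + 1 \<le> level i) \<longleftrightarrow> e \<in> range level" for e
  proof
    assume neq: "(LEAST i. e \<le> level i) \<noteq> (LEAST i. e + 1 \<le> level i)"
    let ?i = "LEAST i. e \<le> level i"
    have "e \<le> level ?i"
      using inc by (rule LeastI_ex)
    moreover have "\<not> e + 1 \<le> level ?i"
    proof
      assume *: "e + 1 \<le> level ?i"
      have "(LEAST i. e + 1 \<le> level i) = ?i"
        by (rule Least_equality) (use * in \<open>auto intro: Least_le\<close>)
      then show False
        using neq by simp
    qed
    ultimately show "e \<in> range level"
      by (metis Suc_eq_plus1 nle_le not_less_eq_eq rangeI)
  next
    assume "e \<in> range level"
    then obtain j where j: "e = level j" by blast
    have "(LEAST i. e \<le> level i) \<le> j"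
      by (rule Least_le) (simp add: j)
    moreover have "e + 1 \<le> level (LEAST i. e + 1 \<le> level i)"
      using inc by (rule LeastI_ex)
    ultimately show "(LEAST i. e \<le> level i) \<noteq> (LEAST i. e + 1 \<le> level i)"
      unfolding j using strict_mono_less_eq[OF strict_mono_level]
      by (metis Suc_eq_plus1 not_less_eq_eq)
  qed
  then have "e > 0 \<Longrightarrow> fib_period a b (P ^ e) \<noteq> fib_period a b (P ^ (e + 1)) \<longleftrightarrow> e \<in> range level" for e
    using fib_period_power[of e] fib_period_power[of "e + 1"] inj by simp
  moreover have "e > 0" if "e \<in> range level" for e
    using that level_pos by auto
  ultimately show ?thesis
    unfolding period_jumps_def by blast
qed

section \<open>Ranks modulo powers of an irreducible polynomial\<close>

abbreviation "rk \<equiv> fib_rank a b P"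

lemma power_P_dvd_gfib_add:
  assumes "e > 0" "P ^ e dvd F m"
  shows "P ^ e dvd F (m + n) \<longleftrightarrow> P ^ e dvd F n"
proof -
  have "P dvd F m"
    using assms by (meson dvd_power dvd_trans)
  then have G: "\<not> P dvd G m"
    by (rule not_P_dvd_gfib0)
  have "F (m + n) - G m * F n = F m * (G n + a * F n)"
    by (simp add: gfib_add algebra_simps)
  then have "P ^ e dvd F (m + n) \<longleftrightarrow> P ^ e dvd G m * F n"
    using assms by (intro dvd_cong_diff) simp
  then show ?thesis
    by (simp add: power_dvd_cancel_left[OF prime_P G])
qed

lemma power_P_dvd_gfib_iff:
  assumes e: "e > 0"
  shows "P ^ e dvd F n \<longleftrightarrow> fib_rank a b (P ^ e) dvd n"
proof -
  have "e \<le> level e"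
    by (rule strict_mono_imp_increasing[OF strict_mono_level])
  then have N: "P ^ e dvd F (N0 * p ^ e)"
    by (simp add: le_level_iff is_period_def)
  have pos: "N0 * p ^ e > 0"
    using period_pos prime_gt_0_nat[OF prime_p] by simp
  show "P ^ e dvd F n \<longleftrightarrow> fib_rank a b (P ^ e) dvd n"
    unfolding fib_rank_def cong_0_iff by (rule Least_pos_dvd_iff(2)[OF power_P_dvd_gfib_add[OF e] N pos])
qed

lemma P_dvd_gfib_iff: "P dvd F n \<longleftrightarrow> rk dvd n"
  using power_P_dvd_gfib_iff[of 1 n] by simp

text \<open>The rank modulo \<open>P\<^sup>e\<close> stays equal to the rank modulo \<open>P\<close> as long as \<open>P\<^sup>e\<close> divides
  \<open>F\<^bsub>rk\<^esub>\<close>. If \<open>F\<^bsub>rk\<^esub> = 0\<close>, the right-hand side is false and no rank jump exists.\<close>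
lemma first_rank_jump_iff:
  "is_ith_smallest 1 (rank_jumps a b P) e1 \<longleftrightarrow> pval P (F rk) = enat e1"
proof -
  have same: "fib_rank a b (P ^ e) = rk \<longleftrightarrow> enat e \<le> pval P (F rk)" if e: "e > 0" for e
  proof -
    have "P ^ e dvd F (fib_rank a b (P ^ e))"
      by (simp add: power_P_dvd_gfib_iff[OF e])
    then have "P dvd F (fib_rank a b (P ^ e))"
      using e by (meson dvd_power dvd_trans)
    then have "rk dvd fib_rank a b (P ^ e)"
      by (simp add: P_dvd_gfib_iff)
    moreover have "enat e \<le> pval P (F rk) \<longleftrightarrow> fib_rank a b (P ^ e) dvd rk"
      by (simp add: pval_ge_iff[OF prime_P] power_P_dvd_gfib_iff[OF e])
    ultimately show ?thesis
      using dvd_antisym by auto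
  qed
  have pos: "pval P (F rk) \<noteq> 0"
    by (simp add: pval_eq_0_iff[OF prime_P] P_dvd_gfib_iff)
  show ?thesis
  proof (cases "pval P (F rk)")
    case infinity
    then have "rank_jumps a b P = {}"
      using same by (auto simp: rank_jumps_def simp del: power_Suc)
    then show ?thesis
      using infinity by (simp add: is_ith_smallest_def)
  next
    case (enat v)
    have v: "v > 0"
      using pos enat by (cases v) (auto simp: zero_enat_def)
    have "e \<notin> rank_jumps a b P" if "e < v" for e
      using that same[of e] same[of "e + 1"] enat by (auto simp: rank_jumps_def)
    moreover have "v \<in> rank_jumps a b P"
      using v same[of v] same[of "v + 1"] enat by (auto simp: rank_jumps_def)
    ultimately show ?thesis
      unfolding is_ith_smallest_1_iff enat by (metis enat.inject linorder_not_le nle_le)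
  qed
qed

section \<open>Cases of geometric growth\<close>

lemma power_P_dvd_gfib_period:
  assumes "e > 0" "P ^ e dvd F rk"
  shows "P ^ e dvd F N0"
proof -
  have "is_period P N0"
    by (simp add: is_period_P_iff)
  then have "rk dvd N0"
    by (simp add: is_period_def P_dvd_gfib_iff)
  then show ?thesis
    using assms dvd_trans by (simp add: power_P_dvd_gfib_iff) blast
qed

text \<open>The hypothesis makes \<open>v\<^sub>P (F\<^sub>N)\<close> larger than \<open>level 0\<close> at \<open>N = N0\<close>, so \<open>level 0\<close> is the valuation of
  \<open>G\<^sub>N - 1\<close>. In \<open>G\<^bsub>Nq\<^esub> - 1 = (G\<^sub>N - 1)\<^sup>q + F\<^sub>N\<^sup>q G\<^sub>q\<close> the first summand then has strictly smaller
  valuation than the second.\<close>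
lemma level_geometric_of_rank:
  assumes "P ^ Suc (level 0) dvd F rk"
  shows "level i = p ^ i * level 0"
proof -
  let ?q = "p ^ i" and ?l = "level 0"
  have q: "?q > 0"
    using prime_gt_0_nat[OF prime_p] by simp
  have F: "P ^ Suc ?l dvd F N0"
    by (rule power_P_dvd_gfib_period[OF _ assms]) simp
  have G: "P ^ n dvd G N0 - 1 \<longleftrightarrow> n \<le> ?l" if "n \<le> Suc ?l" for n
    using le_level_iff[of n 0] power_le_dvd[OF F that] by (simp add: is_period_def)
  have "pval P (G N0 - 1) = enat ?l"
  proof -
    have "enat ?l \<le> pval P (G N0 - 1)"
      using G[of ?l] by (simp add: pval_ge_iff[OF prime_P])
    moreover have "\<not> enat (Suc ?l) \<le> pval P (G N0 - 1)"
      using G[of "Suc ?l"] unfolding pval_ge_iff[OF prime_P] by simp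
    ultimately show ?thesis
      by (cases "pval P (G N0 - 1)") auto
  qed
  then have Gq: "pval P ((G N0 - 1) ^ ?q) = enat (?q * ?l)"
    by (simp add: pval_power[OF prime_P])
  have "P ^ (Suc ?l * ?q) dvd F N0 ^ ?q"
    using dvd_power_same[OF F, of ?q] by (simp only: power_mult)
  moreover have "Suc (?q * ?l) \<le> Suc ?l * ?q"
    using q mult.commute[of ?l ?q] unfolding mult_Suc by linarith
  ultimately have Fq: "P ^ Suc (?q * ?l) dvd F N0 ^ ?q"
    by (rule power_le_dvd)
  have next_power: "P ^ Suc (?q * ?l) dvd G (N0 * ?q) - 1 \<longleftrightarrow> P ^ Suc (?q * ?l) dvd (G N0 - 1) ^ ?q"
    by (rule dvd_cong_diff)
       (use Fq in \<open>simp add: gfib0_mult_power_p_minus_1 del: power_Suc\<close>)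
  have "\<not> Suc (?q * ?l) \<le> level i"
    unfolding le_level_iff is_period_def next_power by (simp add: Gq flip: pval_ge_iff[OF prime_P] del: power_Suc)
  moreover have "?q * ?l \<le> level i"
  proof -
    have "P ^ (?q * ?l) dvd F N0 ^ ?q"
      by (rule power_le_dvd[OF Fq]) simp
    moreover have "P ^ (?q * ?l) dvd (G N0 - 1) ^ ?q"
      by (simp add: Gq flip: pval_ge_iff[OF prime_P])
    ultimately show ?thesis
      unfolding le_level_iff is_period_def gfib0_mult_power_p_minus_1 gfib_mult_power_p(1) by simp
  qed
  ultimately show ?thesis
    by simp
qed

text \<open>If \<open>F\<^sub>q\<close> is prime to \<open>P\<close>, then \<open>1, t\<^sup>q\<close> is a basis modulo \<open>P\<close>, so the valuation of
  \<open>x\<^sup>q + y\<^sup>q t\<^sup>q\<close> is the smaller one of those of \<open>x\<^sup>q\<close> and \<open>y\<^sup>q\<close>. Here \<open>x = G\<^sub>N - 1\<close> and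
  \<open>y = F\<^sub>N\<close> with \<open>N = N0\<close>.\<close>
lemma level_geometric_of_unramified:
  assumes "\<not> P dvd F (p ^ i)"
  shows "level i = p ^ i * level 0"
proof -
  let ?q = "p ^ i"
  let ?x = "pval P (F N0)" and ?y = "pval P (G N0 - 1)"
  have "enat (level i) = min (pval P (F N0 ^ ?q)) (pval P ((G N0 - 1) ^ ?q))"
  proof (rule enat_le_iff_imp_eq)
    fix n
    have "P ^ n dvd F (N0 * ?q) \<longleftrightarrow> P ^ n dvd F N0 ^ ?q"
      using power_dvd_cancel_left[OF prime_P assms] by (simp add: gfib_mult_power_p(1) mult.commute[of "F N0 ^ ?q"])
    moreover have "P ^ n dvd G (N0 * ?q) - 1 \<longleftrightarrow> P ^ n dvd (G N0 - 1) ^ ?q" if "P ^ n dvd F N0 ^ ?q"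
      by (rule dvd_cong_diff) (use that in \<open>simp add: gfib0_mult_power_p_minus_1\<close>)
    ultimately show "enat n \<le> enat (level i) \<longleftrightarrow> enat n \<le> min (pval P (F N0 ^ ?q)) (pval P ((G N0 - 1) ^ ?q))"
      by (auto simp: le_level_iff is_period_def pval_ge_iff[OF prime_P])
  qed
  also have "\<dots> = min (enat ?q * ?x) (enat ?q * ?y)"
    by (simp add: pval_power[OF prime_P])
  also have "\<dots> = enat ?q * min ?x ?y"
    by (cases "?x \<le> ?y") (simp_all add: min_absorb1 min_absorb2 mult_left_mono)
  also have "\<dots> = enat (?q * level 0)"
    using enat_level[of 0] by (simp flip: times_enat_simps(1))
  finally show ?thesis
    by simp
qed

section \<open>Ramified primes in odd characteristic\<close>

text \<open>The rank divides the prime \<open>p\<close>, and it is not 1 because \<open>F\<^sub>1 = 1\<close>.\<close>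

lemma rank_eq_p:
  assumes "P dvd F p"
  shows "rk = p"
proof -
  have "rk dvd p"
    using assms by (simp add: P_dvd_gfib_iff)
  moreover have "rk \<noteq> 1"
    using P_dvd_gfib_iff[of 1] not_P_dvd_1 by auto
  ultimately show ?thesis
    using prime_p by (auto simp: prime_nat_iff)
qed

lemma poly_ord_dvd_iff:
  assumes "\<not> P dvd g"
  shows "poly_ord P g > 0" and "P dvd g ^ n - 1 \<longleftrightarrow> poly_ord P g dvd n"
proof -
  obtain m d where d: "d > 0" "P dvd g ^ (m + d) - g ^ m"
    by (rule ex_recurrent_mod[OF P_nonzero])
  then have "P dvd g ^ m * (g ^ d - 1)"
    by (simp add: power_add right_diff_distrib)
  then have d': "P dvd g ^ d - 1"
    using prime_elem_dvd_multD[OF prime_P] prime_elem_dvd_power[OF prime_P] assms by blast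
  have add: "P dvd g ^ (m + n) - 1 \<longleftrightarrow> P dvd g ^ n - 1" if "P dvd g ^ m - 1" for m n
  proof (rule dvd_cong_diff)
    have "(g ^ (m + n) - 1) - (g ^ n - 1) = g ^ n * (g ^ m - 1)"
      by (simp add: power_add algebra_simps)
    then show "P dvd (g ^ (m + n) - 1) - (g ^ n - 1)"
      using that by simp
  qed
  have eq: "poly_ord P g = (LEAST k. k > 0 \<and> P dvd g ^ k - 1)"
    by (simp add: poly_ord_def cong_iff_dvd_diff)
  show "poly_ord P g > 0"
    unfolding eq by (rule Least_pos_dvd_iff(1)[OF add d' d(1)])
  show "P dvd g ^ n - 1 \<longleftrightarrow> poly_ord P g dvd n"
    unfolding eq by (rule Least_pos_dvd_iff(2)[OF add d' d(1)])
qed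

text \<open>The ring of residues modulo \<open>P\<close> is reduced: if \<open>(g\<^sup>c)\<^sup>p = 1\<close> modulo \<open>P\<close>, then \<open>P\<close> divides
  \<open>(g\<^sup>c - 1)\<^sup>p\<close> and so \<open>g\<^sup>c = 1\<close> modulo \<open>P\<close>.\<close>
lemma not_p_dvd_poly_ord:
  assumes "\<not> P dvd g"
  shows "\<not> p dvd poly_ord P g"
proof
  assume "p dvd poly_ord P g"
  then obtain c where c: "poly_ord P g = c * p"
    by (metis dvdE mult.commute)
  have "P dvd (g ^ c) ^ (CHAR('a poly) ^ 1) - 1"
    using poly_ord_dvd_iff(2)[OF assms, of "poly_ord P g"] by (simp add: c char power_mult)
  then have "P dvd g ^ c - 1"
    unfolding power_CHAR_minus_one[OF prime_p'] by (rule prime_elem_dvd_power[OF prime_P])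
  then have "c * p dvd c"
    using poly_ord_dvd_iff(2)[OF assms, of c] c by simp
  then have "c = 0 \<or> p = 1"
    using prime_gt_1_nat[OF prime_p] by (metis dvd_mult_cancel1 mult_dvd_mono gr0I nat_dvd_1_iff_1)
  then show False
    using poly_ord_dvd_iff(1)[OF assms] c prime_gt_1_nat[OF prime_p] by simp
qed

text \<open>Modulo \<open>P\<close> the square \<open>D\<close> of \<open>t - h\<close> vanishes, so \<open>t\<^sup>n = h\<^sup>n + n h\<^bsup>n - 1\<^esup> (t - h)\<close>. This equals 1
  iff both \<open>p\<close> and \<open>k\<close> divide \<open>n\<close>, so the period is \<open>k p\<close>. With \<open>q = p\<^bsup>i + 1\<^esup>\<close> the two entries of
  the minimum are the valuations of the coordinates of \<open>t\<^bsup>kq\<^esup> - 1\<close> in the basis \<open>1, t - h\<close>,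
  where terms divisible by \<open>D\<^sup>q\<close> may be dropped since \<open>F\<^sub>q\<close> divides \<open>D\<^sup>q\<close>.\<close>
lemma level_odd_ramified:
  fixes h :: "'a poly"
  assumes odd: "p \<noteq> 2" and a: "a = 2 * h" and PD: "P dvd h ^ 2 + b"
  defines "D \<equiv> h ^ 2 + b" and "k \<equiv> poly_ord P h"
  shows "rk = p"
    and "enat (level i) = min (pval P (h ^ k - 1) * enat (p ^ Suc i)) (pval P (F (p ^ Suc i)))"
proof -
  have p2: "p > 2"
    using prime_gt_1_nat[OF prime_p] odd by simp
  have oddp: "odd (p ^ j)" for j
    using prime_odd_nat[OF prime_p p2] by simp
  have Fq: "F (p ^ j) = D ^ ((p ^ j - 1) div 2)" and Gq: "G (p ^ j) + h * F (p ^ j) = h ^ (p ^ j)" for j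
    using gfib_power_CHAR_odd[OF prime_p' a, of j "(p ^ j - 1) div 2" b] oddp[of j] unfolding D_def
    by (simp_all add: char)
  have "(p ^ 1 - 1) div 2 > 0"
    using p2 by simp
  then have "P dvd F (p ^ 1)"
    unfolding Fq using PD by (metis D_def dvd_power dvd_trans)
  then show rk: "rk = p"
    by (intro rank_eq_p) simp
  have h: "\<not> P dvd h"
  proof
    assume "P dvd h"
    then have "P dvd (h ^ 2 + b) - h * h"
      using PD by simp
    then show False
      using not_P_dvd_b by (simp add: power2_eq_square)
  qed
  note ord = poly_ord_dvd_iff[OF h, folded k_def]
  have pk: "\<not> p dvd k"
    unfolding k_def by (rule not_p_dvd_poly_ord[OF h])
  have is_period: "is_period P n \<longleftrightarrow> p dvd n \<and> k dvd n" for n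
  proof (cases "P dvd F n")
    case True
    have "P dvd G n + h * F n - h ^ n"
      using gfib0_plus_half[OF a] PD dvd_trans by blast
    then have "P dvd (G n + h * F n - h ^ n) - h * F n"
      using True by (metis dvd_diff dvd_mult)
    then have "P dvd G n - 1 \<longleftrightarrow> P dvd h ^ n - 1"
      by (intro dvd_cong_diff) (simp add: algebra_simps)
    then show ?thesis
      using True by (simp add: is_period_def ord P_dvd_gfib_iff rk)
  qed (simp add: is_period_def P_dvd_gfib_iff rk)
  have "coprime k p"
    using prime_imp_coprime[OF prime_p pk] by (simp add: coprime_commute)
  then have "N0 dvd n \<longleftrightarrow> k * p dvd n" for n
    using is_period[of n] is_period_P_iff[of n] by (auto intro: divides_mult dvd_mult_left dvd_mult_right)
  then have N0: "N0 = k * p"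
    by (meson dvd_antisym dvd_refl)
  let ?q = "p ^ Suc i"
  have Nq: "N0 * p ^ i = k * ?q"
    by (simp add: N0)
  have Fk: "\<not> P dvd F k ^ ?q"
    using pk prime_elem_dvd_power[OF prime_P] by (auto simp: P_dvd_gfib_iff[symmetric] rk[symmetric] simp del: power_Suc)
  have F: "P ^ n dvd F (k * ?q) \<longleftrightarrow> P ^ n dvd F ?q" for n
    unfolding gfib_mult_power_p(1) by (rule power_dvd_cancel_left[OF prime_P Fk])
  obtain y where y: "G k + h * F k - h ^ k = D * y"
    using gfib0_plus_half[OF a, of b k] unfolding D_def by (auto elim: dvdE)
  have frob: "(x + z) ^ ?q = x ^ ?q + z ^ ?q" for x z :: "'a poly"
    by (rule freshmans_dream'[where n = "Suc i", OF prime_p']) (simp add: char)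
  \<comment> \<open>Adding \<open>h F\<close> to the constant coordinate passes from the basis \<open>1, t\<close> to \<open>1, t - h\<close>.\<close>
  have "G (k * ?q) - 1 + h * F (k * ?q) = (G k - 1) ^ ?q + F k ^ ?q * (G ?q + h * F ?q)"
    unfolding gfib0_mult_power_p_minus_1 gfib_mult_power_p(1) by (simp add: algebra_simps)
  also have "\<dots> = ((G k - 1) + F k * h) ^ ?q"
    unfolding Gq frob power_mult_distrib ..
  also have "(G k - 1) + F k * h = (h ^ k - 1) + D * y"
    using y by (simp add: algebra_simps)
  also have "\<dots> ^ ?q = (h ^ k - 1) ^ ?q + D ^ ?q * y ^ ?q"
    by (simp only: frob power_mult_distrib)
  finally have diff: "G (k * ?q) - 1 - (h ^ k - 1) ^ ?q = D ^ ?q * y ^ ?q - h * F (k * ?q)"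
    by (simp add: algebra_simps)
  have "F ?q dvd D ^ ?q"
    unfolding Fq by (rule le_imp_power_dvd) simp
  then have G: "P ^ n dvd G (k * ?q) - 1 \<longleftrightarrow> P ^ n dvd (h ^ k - 1) ^ ?q" if "P ^ n dvd F ?q" for n
    by (intro dvd_cong_diff, unfold diff)
       (intro dvd_diff dvd_mult2 dvd_mult dvd_trans[OF that] that F[THEN iffD2])
  show "enat (level i) = min (pval P (h ^ k - 1) * enat ?q) (pval P (F ?q))"
  proof (rule enat_le_iff_imp_eq)
    fix n
    show "enat n \<le> enat (level i) \<longleftrightarrow> enat n \<le> min (pval P (h ^ k - 1) * enat ?q) (pval P (F ?q))"
      using F[of n] G[of n]
      by (auto simp: le_level_iff is_period_def Nq pval_ge_iff[OF prime_P] mult.commute[of _ "enat ?q"]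
            pval_power[OF prime_P, symmetric] simp del: power_Suc)
  qed
qed

section \<open>Ramified primes in characteristic 2\<close>

text \<open>In characteristic 2, \<open>G\<^bsub>2n\<^esub> = G\<^sub>n\<^sup>2 + b F\<^sub>n\<^sup>2\<close> differs from the norm of \<open>t\<^sup>n\<close> only by the mixed term.\<close>

lemma gfib0_double_norm:
  assumes "p = 2"
  shows "G (2 * n) = b ^ n - a * G n * F n"
proof -
  have neg: "- x = x" for x :: "'a poly"
    using assms by (simp add: uminus_CHAR_2 char)
  have "G (2 * n) = G n ^ 2 + (- (b * F n ^ 2))"
    unfolding neg by (rule gfib_double_CHAR_2(2)) (simp add: char assms)
  also have "\<dots> = (- b) ^ n - a * G n * F n"
    unfolding gfib_norm[of a b n, symmetric] by simp
  finally show ?thesis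
    unfolding neg .
qed

text \<open>Modulo \<open>P\<close> one has \<open>t\<^sup>2 = b\<close>. So \<open>t\<^sup>n\<close> is scalar iff \<open>n\<close> is even, and for \<open>n = 2 j\<close> its value
  is \<open>b\<^sup>j\<close>.\<close>
lemma char_2_ramified:
  assumes p2: "p = 2" and Pa: "P dvd a"
  defines "k \<equiv> poly_ord P b"
  shows "rk = 2" and "N0 = k * 2" and "odd k"
proof -
  have "F 2 = a"
    by (simp add: numeral_2_eq_2 gfib.simps(3))
  then show rk: "rk = 2"
    using rank_eq_p Pa p2 by simp
  note ord = poly_ord_dvd_iff[OF not_P_dvd_b, folded k_def]
  show odd: "odd k"
    using not_p_dvd_poly_ord[OF not_P_dvd_b] p2 by (simp add: k_def)
  have is_period: "is_period P n \<longleftrightarrow> k * 2 dvd n" for n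
  proof (cases "even n")
    case True
    then obtain j where n: "n = 2 * j" by blast
    have "P dvd G n - 1 \<longleftrightarrow> P dvd b ^ j - 1"
      by (rule dvd_cong_diff) (use Pa in \<open>simp add: n gfib0_double_norm[OF p2]\<close>)
    then show ?thesis
      using P_dvd_gfib_iff[of n] by (simp add: is_period_def ord rk n mult.commute[of 2])
  next
    case False
    then show ?thesis
      using P_dvd_gfib_iff[of n] rk by (auto simp: is_period_def dest: dvd_mult_right)
  qed
  then have "N0 dvd n \<longleftrightarrow> k * 2 dvd n" for n
    by (simp flip: is_period_P_iff)
  then show "N0 = k * 2"
    by (meson dvd_antisym dvd_refl)
qed

lemma level_char_2_ramified:
  assumes p2: "p = 2" and Pa: "P dvd a"
  defines "k \<equiv> poly_ord P b"
  shows "enat (level i) = min (pval P (a ^ (2 ^ Suc i - 1))) (pval P (G (k * 2 ^ Suc i) - 1))"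
proof -
  have rk: "rk = 2" and N0: "N0 = k * 2" and odd: "odd k"
    unfolding k_def by (rule char_2_ramified[OF p2 Pa])+
  have Nq: "N0 * p ^ i = k * 2 ^ Suc i"
    by (simp add: N0 p2)
  have Fk: "\<not> P dvd F k ^ (2 ^ Suc i)"
    using odd prime_elem_dvd_power[OF prime_P, of "F k"] P_dvd_gfib_iff[of k] by (auto simp: rk)
  have "F (k * 2 ^ Suc i) = F k ^ (2 ^ Suc i) * a ^ (2 ^ Suc i - 1)"
    using gfib_mult_power_p(1)[of k "Suc i"] gfib_power_2_CHAR_2[of a b "Suc i"]
    unfolding p2 by (simp only: semiring_char_poly char p2)
  then have "pval P (F (k * 2 ^ Suc i)) = pval P (a ^ (2 ^ Suc i - 1))"
    using pval_eq_0_iff[OF prime_P] Fk by (simp add: pval_mult[OF prime_P] del: power_Suc)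
  then show ?thesis
    using enat_level[of i] unfolding Nq by (simp only:)
qed

text \<open>Put \<open>d\<^sub>i = G\<^sub>n - 1\<close> for \<open>n = k 2\<^sup>i\<close>. Doubling gives
  \<open>d\<^bsub>i+1\<^esub> = d\<^sub>i\<^sup>2 + b F\<^sub>n\<^sup>2\<close>, where \<open>F\<^sub>n\<^sup>2\<close> is \<open>F\<^sub>k\<close> to the power \<open>2\<^bsup>i+1\<^esup>\<close> times the power of \<open>a\<close> that
  occurs in the recurrence of \<open>c\<close>. The norm shows \<open>b F\<^sub>k\<^sup>2 = 1\<close> modulo \<open>P\<^sup>v\<close>, so after
  multiplying \<open>d\<^sub>i\<close> by \<open>b\<close> to the power \<open>2\<^bsup>i-1\<^esup> - 1\<close> both sequences satisfy the same recurrence up to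
  a small error. The modulus \<open>P\<close> to the power \<open>2\<^sup>i v\<close> is preserved by this recurrence, since squaring
  a congruence in characteristic 2 squares its modulus. The first claim is the case \<open>i = 1\<close>; it is separate because
  the divisibility of \<open>b\<^sup>k - 1\<close> that the second claim assumes is deduced from it.\<close>
lemma norm_sequence_cong:
  assumes p2: "p = 2" and k: "odd k" and v: "P ^ v dvd a"
  shows "P ^ (2 * v) dvd (b ^ k - 1) - (G (k * 2) - 1)"
    and "\<lbrakk>P ^ v dvd b ^ k - 1; c 1 = b ^ k - 1; \<forall>i\<ge>2. c i = a ^ (2 ^ i - 2) + b * c (i - 1) ^ 2; i \<ge> 1\<rbrakk>
      \<Longrightarrow> P ^ (2 ^ i * v) dvd c i - b ^ (2 ^ (i - 1) - 1) * (G (k * 2 ^ i) - 1)"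
proof -
  have char2: "CHAR('a poly) = 2"
    by (simp add: char p2)
  have neg: "- x = x" for x :: "'a poly"
    using char2 by (simp add: uminus_CHAR_2)
  have minus: "x - y = x + y" for x y :: "'a poly"
    using neg[of y] by (metis diff_conv_add_uminus)
  obtain j where j: "k = Suc (2 * j)"
    using k oddE by fastforce
  \<comment> \<open>As \<open>k\<close> is odd, the power of \<open>t\<close> with exponent \<open>k - 1 = 2 j\<close> is scalar modulo \<open>a\<close>.\<close>
  have "G k = a * (b * F j ^ 2)"
    unfolding j gfib0_Suc gfib_double_CHAR_2(1)[OF char2] by simp
  then have aG: "a dvd G k" by simp
  have vn: "P ^ (n * v) dvd a ^ n" for n
    using dvd_power_same[OF v, of n] by (simp add: power_mult[symmetric] mult.commute)
  have "(b ^ k - 1) - (G (k * 2) - 1) = a * G k * F k"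
    by (simp add: gfib0_double_norm[OF p2] mult.commute[of k])
  moreover have "a ^ 2 dvd a * G k * F k"
    unfolding power2_eq_square by (intro dvd_mult2 mult_dvd_mono dvd_refl aG)
  ultimately show base: "P ^ (2 * v) dvd (b ^ k - 1) - (G (k * 2) - 1)"
    using vn[of 2] dvd_trans by metis
  assume m: "P ^ v dvd b ^ k - 1" and c1: "c 1 = b ^ k - 1"
    and c: "\<forall>i\<ge>2. c i = a ^ (2 ^ i - 2) + b * c (i - 1) ^ 2"
  have bF: "P ^ v dvd b * F k ^ 2 - 1"
  proof -
    have "G k ^ 2 + a * G k * F k - b * F k ^ 2 = b ^ k"
      using gfib_norm[of a b k] unfolding neg[of b] .
    then have "b * F k ^ 2 = G k * (G k + a * F k) - b ^ k"
      by (simp add: algebra_simps power2_eq_square)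
    then have "b * F k ^ 2 - 1 = G k * (G k + a * F k) - (b ^ k + 1)"
      by simp
    then have "b * F k ^ 2 - 1 = G k * (G k + a * F k) - (b ^ k - 1)"
      by (simp only: minus[of "b ^ k" 1])
    moreover have "P ^ v dvd G k"
      using v aG dvd_trans by blast
    ultimately show ?thesis
      using m by (metis dvd_diff dvd_mult2)
  qed
  define d where "d i = G (k * 2 ^ i) - 1" for i
  have d: "d (Suc i) = d i ^ 2 + b * F k ^ (2 ^ Suc i) * a ^ (2 ^ Suc i - 2)" for i
  proof -
    have "F (k * 2 ^ i) = F k ^ (2 ^ i) * a ^ (2 ^ i - 1)"
      using gfib_mult_power_p(1)[of k i] gfib_power_2_CHAR_2[OF char2, of a b i] unfolding p2
      by (simp only:)
    moreover have "2 ^ i * 2 = (2 ^ Suc i :: nat)" "(2 ^ i - 1) * 2 = (2 ^ Suc i - 2 :: nat)"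
      by simp_all
    ultimately have "F (k * 2 ^ i) ^ 2 = F k ^ (2 ^ Suc i) * a ^ (2 ^ Suc i - 2)"
      by (simp only: power_mult_distrib power_mult[symmetric])
    moreover have "d (Suc i) = d i ^ 2 + b * F (k * 2 ^ i) ^ 2"
    proof -
      have "k * 2 ^ Suc i = 2 * (k * 2 ^ i)"
        by simp
      then have "d (Suc i) = G (k * 2 ^ i) ^ 2 - 1 + b * F (k * 2 ^ i) ^ 2"
        unfolding d_def using gfib_double_CHAR_2(2)[OF char2, of a b "k * 2 ^ i"]
        by (simp only: diff_add_eq)
      also have "G (k * 2 ^ i) ^ 2 - 1 = d i ^ 2"
        unfolding d_def using power_CHAR_minus_one[OF prime_p', of "G (k * 2 ^ i)" 1]
        by (simp only: char2 power_one_right)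
      finally show ?thesis .
    qed
    ultimately show ?thesis
      by (simp add: mult.assoc)
  qed
  have "P ^ (2 ^ Suc i * v) dvd c (Suc i) - b ^ (2 ^ i - 1) * d (Suc i)" for i
  proof (induction i)
    case 0
    then show ?case
      using base by (simp add: c1[unfolded One_nat_def] d_def)
  next
    case (Suc i)
    let ?s = "2 ^ i - 1 :: nat" and ?q = "2 ^ Suc i :: nat"
    have q2: "?q \<ge> 2"
      using one_le_power[of "2 :: nat" i] by simp
    have sq: "c (Suc i) ^ 2 - (b ^ ?s * d (Suc i)) ^ 2 = (c (Suc i) - b ^ ?s * d (Suc i)) ^ 2"
      using freshmans_dream'[of 2 1 "c (Suc i)" "b ^ ?s * d (Suc i)"] char2 unfolding minus by simp
    have pw: "(b * F k ^ 2) ^ ?q - 1 = (b * F k ^ 2 - 1) ^ ?q"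
      using power_CHAR_minus_one[of "b * F k ^ 2" "Suc i"] char2 by simp
    have s1: "b ^ (?q - 1) = b * (b ^ ?s) ^ 2"
    proof -
      have "?q - 1 = Suc (?s * 2)"
        using one_le_power[of "2 :: nat" i] unfolding power_Suc by linarith
      then show ?thesis
        by (simp only: power_Suc power_mult)
    qed
    have s2: "b ^ (?q - 1) * (b * F k ^ (2 ^ Suc (Suc i))) = (b * F k ^ 2) ^ ?q"
    proof -
      have "b ^ ?q = b ^ (?q - 1) * b"
        using q2 by (metis power_minus_mult less_le_trans pos2)
      moreover have "(F k ^ 2) ^ ?q = F k ^ (2 ^ Suc (Suc i))"
        by (simp only: power_Suc power_mult)
      ultimately show ?thesis
        by (simp only: power_mult_distrib mult.assoc)
    qed
    have cS: "c (Suc (Suc i)) = a ^ (2 ^ Suc (Suc i) - 2) + b * c (Suc i) ^ 2"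
      using c[rule_format, of "Suc (Suc i)"] by (simp del: power_Suc)
    have "c (Suc (Suc i)) - b ^ (?q - 1) * d (Suc (Suc i))
        = a ^ (2 ^ Suc (Suc i) - 2) + b * c (Suc i) ^ 2
          - (b ^ (?q - 1) * d (Suc i) ^ 2
              + b ^ (?q - 1) * (b * F k ^ (2 ^ Suc (Suc i))) * a ^ (2 ^ Suc (Suc i) - 2))"
      unfolding cS d[of "Suc i"] by (simp only: distrib_left mult.assoc)
    also have "\<dots> = b * (c (Suc i) ^ 2 - (b ^ ?s * d (Suc i)) ^ 2)
          - ((b * F k ^ 2) ^ ?q - 1) * a ^ (2 ^ Suc (Suc i) - 2)"
      unfolding s2 unfolding s1 by (simp add: algebra_simps power_mult_distrib del: power_Suc)
    finally have eq: "c (Suc (Suc i)) - b ^ (?q - 1) * d (Suc (Suc i))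
        = b * (c (Suc i) - b ^ ?s * d (Suc i)) ^ 2
          - (b * F k ^ 2 - 1) ^ ?q * a ^ (2 ^ Suc (Suc i) - 2)"
      unfolding sq pw .
    have "P ^ (2 ^ Suc (Suc i) * v) dvd (c (Suc i) - b ^ ?s * d (Suc i)) ^ 2"
      using dvd_power_same[OF Suc.IH, of 2] by (simp add: mult_ac flip: power_mult)
    moreover have "P ^ (2 ^ Suc (Suc i) * v) dvd (b * F k ^ 2 - 1) ^ ?q * a ^ (2 ^ Suc (Suc i) - 2)"
    proof -
      have "P ^ (2 * v) dvd (P ^ v) ^ ?q"
        using q2 by (simp only: power_mult[symmetric] mult.commute[of v] le_imp_power_dvd mult_le_mono1)
      also have "\<dots> dvd (b * F k ^ 2 - 1) ^ ?q"
        by (rule dvd_power_same[OF bF])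
      finally have "P ^ (2 * v) * P ^ ((2 ^ Suc (Suc i) - 2) * v)
          dvd (b * F k ^ 2 - 1) ^ ?q * a ^ (2 ^ Suc (Suc i) - 2)"
        by (rule mult_dvd_mono[OF _ vn])
      moreover have "2 * v + (2 ^ Suc (Suc i) - 2) * v = 2 ^ Suc (Suc i) * v"
      proof -
        have "2 + (2 ^ Suc (Suc i) - 2) = (2 ^ Suc (Suc i) :: nat)"
          using q2 unfolding power_Suc by linarith
        then show ?thesis
          by (metis distrib_right)
      qed
      ultimately show ?thesis
        by (simp only: power_add[symmetric])
    qed
    ultimately show ?case
      unfolding eq by (rule dvd_diff[OF dvd_mult])
  qed
  note * = this
  assume "i \<ge> 1"
  then show "P ^ (2 ^ i * v) dvd c i - b ^ (2 ^ (i - 1) - 1) * (G (k * 2 ^ i) - 1)"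
    using *[of "i - 1"] by (simp add: d_def)
qed

section \<open>The period jumps in terms of the discriminant\<close>

lemma eq_twice_half:
  assumes "p \<noteq> 2"
  shows "x = 2 * smult (1 / 2) (x :: 'a poly)"
proof -
  have "(2 :: 'a) \<noteq> 0"
    using of_nat_eq_0_iff_char_dvd[where ?'a = 'a, of 2] primes_dvd_imp_eq[OF prime_p two_is_prime_nat] assms
    by (auto simp: char)
  then have "(1 / 2 + 1 / 2 :: 'a) = 1"
    by (simp flip: add_divide_distrib)
  then show ?thesis
    unfolding mult_2 smult_add_left[symmetric] by simp
qed

lemma gfib_power_p_odd:
  assumes "p \<noteq> 2" and "a = 2 * h"
  shows "F (p ^ i) = (h ^ 2 + b) ^ ((p ^ i - 1) div 2)"
proof -
  have "odd p"
    using prime_odd_nat[OF prime_p] prime_gt_1_nat[OF prime_p] assms(1) by simp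
  then show ?thesis
    using gfib_power_CHAR_odd(1)[OF prime_p' assms(2), of i "(p ^ i - 1) div 2" b] by (simp add: char)
qed

lemma P_dvd_fib_discr_iff:
  assumes "p \<noteq> 2" and "a = 2 * h"
  shows "P dvd fib_discr a b \<longleftrightarrow> P dvd h ^ 2 + b"
    and "fib_discr a b = 0 \<longleftrightarrow> h ^ 2 + b = 0"
proof -
  have "1 = 2 * smult (1 / 2) (1 :: 'a poly)"
    by (rule eq_twice_half[OF assms(1)])
  then have 2: "\<not> P dvd 2"
    using not_P_dvd_1 by (metis dvd_mult2)
  have eq: "fib_discr a b = 2 * (2 * (h ^ 2 + b))"
    by (simp add: fib_discr_def assms(2) algebra_simps power2_eq_square)
  show "P dvd fib_discr a b \<longleftrightarrow> P dvd h ^ 2 + b"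
    unfolding eq using 2 by (simp only: prime_elem_dvd_mult_iff[OF prime_P] simp_thms)
  show "fib_discr a b = 0 \<longleftrightarrow> h ^ 2 + b = 0"
    unfolding eq using 2 by (metis dvd_0_right mult_eq_0_iff)
qed

lemma fib_discr_char_2:
  assumes "p = 2"
  shows "fib_discr a b = a ^ 2"
proof -
  have "(2 :: 'a poly) = 0"
    using of_nat_CHAR[where ?'a = "'a poly"] assms by (simp add: char)
  then have "(4 :: 'a poly) = 0"
    by (metis mult_2 mult_zero_left numeral_Bit0)
  then show ?thesis
    by (simp add: fib_discr_def)
qed

lemma gfib_power_p_char_2: "p = 2 \<Longrightarrow> F (p ^ i) = a ^ (p ^ i - 1)"
  using gfib_power_2_CHAR_2[of a b i] by (simp add: char)

lemma level_geometric_of_discr: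
  assumes "\<not> P dvd fib_discr a b"
  shows "level i = p ^ i * level 0"
proof (rule level_geometric_of_unramified)
  have "\<exists>x j. F (p ^ i) = x ^ j \<and> \<not> P dvd x"
  proof (cases "p = 2")
    case True
    then show ?thesis
      using assms gfib_power_p_char_2 fib_discr_char_2 by (metis dvd_power dvd_trans pos2)
  next
    case False
    then show ?thesis
      using assms gfib_power_p_odd P_dvd_fib_discr_iff(1) eq_twice_half by metis
  qed
  then show "\<not> P dvd F (p ^ i)"
    using prime_elem_dvd_power[OF prime_P] by auto
qed

lemma gfib_rank_eq_0_of_discr:
  assumes "fib_discr a b = 0"
  shows "F rk = 0"
proof -
  have "F (p ^ 1) = 0"
  proof (cases "p = 2")
    case True
    then have "a = 0"
      using assms by (simp add: fib_discr_char_2)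
    then show ?thesis
      unfolding gfib_power_p_char_2[OF True] by (simp add: True)
  next
    case False
    then have "(p ^ 1 - 1) div 2 > 0"
      using prime_gt_1_nat[OF prime_p] by simp
    moreover have "F (p ^ 1) = 0 ^ ((p ^ 1 - 1) div 2)"
      unfolding gfib_power_p_odd[OF False eq_twice_half[OF False]]
      using P_dvd_fib_discr_iff(2)[OF False eq_twice_half[OF False]] assms by simp
    ultimately show ?thesis
      by simp
  qed
  then show ?thesis
    using rank_eq_p by simp
qed

text \<open>Here \<open>v\<^sub>P (F\<^sub>q) = (q - 1) / 2 * v\<^sub>P (D)\<close> for \<open>q = p\<^bsup>i + 1\<^esup>\<close>, and the case \<open>q = p\<close> expresses
  \<open>v\<^sub>P (D)\<close> through \<open>e1\<close>.\<close>
lemma level_odd_ramified_formula: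
  assumes p2: "p \<noteq> 2" and P: "P dvd fib_discr a b" and e1: "pval P (F rk) = enat e1"
  defines "h \<equiv> smult (1 / 2) a"
  shows "enat (level i) = min (pval P (h ^ poly_ord P h - 1) * enat (p ^ Suc i))
    (enat ((p ^ Suc i - 1) * e1 div (p - 1)))"
proof -
  have a: "a = 2 * h"
    unfolding h_def by (rule eq_twice_half[OF p2])
  note F = gfib_power_p_odd[OF p2 a]
  have PD: "P dvd h ^ 2 + b"
    using P P_dvd_fib_discr_iff(1)[OF p2 a] by simp
  have odd: "odd p"
    using prime_odd_nat[OF prime_p] prime_gt_1_nat[OF prime_p] p2 by simp
  define j J where "j = (p - 1) div 2" and "J = (p ^ Suc i - 1) div 2"
  have j: "p - 1 = 2 * j" "j > 0"
    using odd prime_gt_1_nat[OF prime_p] p2 unfolding j_def by auto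
  have J: "p ^ Suc i - 1 = 2 * J"
    using odd unfolding J_def by simp
  have "enat e1 = enat j * pval P (h ^ 2 + b)"
    using F[of 1] e1 level_odd_ramified(1)[OF p2 a PD]
    by (simp add: pval_power[OF prime_P] j_def)
  then obtain v where v: "pval P (h ^ 2 + b) = enat v" and e1': "e1 = j * v"
    using j(2) by (cases "pval P (h ^ 2 + b)") (auto simp: zero_enat_def)
  have "pval P (F (p ^ Suc i)) = enat (J * v)"
    unfolding F J_def by (simp add: pval_power[OF prime_P] v)
  moreover have "(p ^ Suc i - 1) * e1 div (p - 1) = J * v"
    unfolding j(1) J e1' using j(2) by (simp add: mult.assoc mult.left_commute[of J j])
  ultimately show ?thesis
    using level_odd_ramified(2)[OF p2 a PD, of i] by simp
qed

text \<open>For \<open>n \<le> (2\<^bsup>i + 1\<^esup> - 1) e1\<close>, \<open>P\<^sup>n\<close> divides \<open>c\<^bsub>i + 1\<^esub>\<close> iff it divides \<open>G\<^bsub>kq\<^esub> - 1\<close> with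
  \<open>q = 2\<^bsup>i + 1\<^esup>\<close>, because the error in \<open>norm_sequence_cong\<close> is divisible by \<open>P\<^bsup>q e1\<^esup>\<close>. If
  \<open>m > e1\<close>, then in \<open>c\<^sub>2 = a\<^sup>2 + b c\<^sub>1\<^sup>2\<close> the first summand has the smaller valuation \<open>2 e1\<close>, and in
  every later step the square has.\<close>
lemma level_char_2_formulas:
  fixes e1 :: nat
  assumes p2: "p = 2" and P: "P dvd fib_discr a b" and e1: "pval P (F rk) = enat e1" and l0: "level 0 = e1"
  defines "k \<equiv> poly_ord P b"
  defines "m \<equiv> pval P (b ^ k - 1)"
  shows "m \<ge> enat e1"
    and "\<lbrakk>c 1 = b ^ k - 1; \<forall>i\<ge>2. c i = a ^ (2 ^ i - 2) + b * c (i - 1) ^ 2\<rbrakk>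
      \<Longrightarrow> enat (level i) = min (enat ((2 ^ Suc i - 1) * e1)) (pval P (c (Suc i)))"
    and "m > enat e1 \<Longrightarrow> level i = 2 ^ i * e1"
proof -
  have Pa: "P dvd a"
    by (rule prime_elem_dvd_power[OF prime_P P[unfolded fib_discr_char_2[OF p2]]])
  have "F 2 = a"
    using gfib_power_p_char_2[OF p2, of 1] p2 by simp
  then have va: "pval P a = enat e1"
    using e1 char_2_ramified(1)[OF p2 Pa] by simp
  then have Pva: "P ^ e1 dvd a"
    by (simp flip: pval_ge_iff[OF prime_P])
  have k: "odd k"
    unfolding k_def by (rule char_2_ramified(3)[OF p2 Pa])
  have lev: "enat (level i) = min (enat ((2 ^ Suc i - 1) * e1)) (pval P (G (k * 2 ^ Suc i) - 1))" for i
    using level_char_2_ramified[OF p2 Pa, of i] by (simp add: pval_power[OF prime_P] va k_def)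
  have "enat e1 = min (enat e1) (pval P (G (k * 2) - 1))"
    using lev[of 0] l0 by simp
  then have "enat e1 \<le> pval P (G (k * 2) - 1)"
    by (metis min.cobounded2)
  then have "P ^ e1 dvd G (k * 2) - 1"
    by (simp add: pval_ge_iff[OF prime_P])
  moreover have "P ^ e1 dvd (b ^ k - 1) - (G (k * 2) - 1)"
    by (rule power_le_dvd[OF norm_sequence_cong(1)[OF p2 k Pva]]) simp
  ultimately have Pm: "P ^ e1 dvd b ^ k - 1"
    by (metis dvd_cong_diff)
  then show m: "m \<ge> enat e1"
    by (simp add: m_def pval_ge_iff[OF prime_P])
  show formula: "enat (level i) = min (enat ((2 ^ Suc i - 1) * e1)) (pval P (c (Suc i)))"
    if c: "c 1 = b ^ k - 1" "\<forall>i\<ge>2. c i = a ^ (2 ^ i - 2) + b * c (i - 1) ^ 2" for c i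
  proof (rule enat_le_iff_imp_eq)
    fix n
    have "P ^ n dvd c (Suc i) \<longleftrightarrow> P ^ n dvd G (k * 2 ^ Suc i) - 1" if n: "n \<le> (2 ^ Suc i - 1) * e1"
    proof -
      have "n \<le> 2 ^ Suc i * e1"
        by (rule le_trans[OF n]) simp
      then have "P ^ n dvd c (Suc i) - b ^ (2 ^ i - 1) * (G (k * 2 ^ Suc i) - 1)"
        using norm_sequence_cong(2)[OF p2 k Pva Pm c, of "Suc i"] power_le_dvd by auto
      then have cong: "P ^ n dvd c (Suc i) \<longleftrightarrow> P ^ n dvd b ^ (2 ^ i - 1) * (G (k * 2 ^ Suc i) - 1)"
        by (rule dvd_cong_diff)
      have unit: "\<not> P dvd b ^ (2 ^ i - 1)"
        using prime_elem_dvd_power[OF prime_P] not_P_dvd_b by blast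
      show ?thesis
        unfolding cong by (rule power_dvd_cancel_left[OF prime_P unit])
    qed
    then show "enat n \<le> enat (level i) \<longleftrightarrow> enat n \<le> min (enat ((2 ^ Suc i - 1) * e1)) (pval P (c (Suc i)))"
      unfolding lev by (auto simp: pval_ge_iff[OF prime_P])
  qed
  show "level i = 2 ^ i * e1" if m_gt: "m > enat e1"
  proof (cases i)
    case 0
    then show ?thesis
      by (simp add: l0)
  next
    case (Suc i')
    \<comment> \<open>The formula in terms of \<open>c\<close> also applies here, to an explicitly constructed sequence.\<close>
    define c where "c j = rec_nat (b ^ k - 1) (\<lambda>n x. a ^ (2 ^ (n + 2) - 2) + b * x ^ 2) (j - 1)" for j
    have c1: "c 1 = b ^ k - 1"
      by (simp add: c_def)
    have c: "\<forall>i\<ge>2. c i = a ^ (2 ^ i - 2) + b * c (i - 1) ^ 2"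
    proof (intro allI impI)
      fix i :: nat assume "i \<ge> 2"
      then obtain n where "i = n + 2"
        by (metis add.commute le_Suc_ex)
      then show "c i = a ^ (2 ^ i - 2) + b * c (i - 1) ^ 2"
        by (simp add: c_def)
    qed
    have pb: "pval P (b * x ^ 2) = 2 * pval P x" for x
      using pval_eq_0_iff[OF prime_P, of b] not_P_dvd_b
      by (simp add: pval_mult[OF prime_P] pval_power[OF prime_P] numeral_eq_enat)
    have pos: "e1 > 0"
      using level_pos[of 0] l0 by simp
    have "pval P (c (Suc (Suc n))) = enat (2 ^ Suc n * e1)" for n
    proof (induction n)
      case 0
      have "c 2 = a ^ 2 + b * (b ^ k - 1) ^ 2"
        using c[rule_format, of 2] c1 by simp
      moreover have "pval P (a ^ 2) < pval P (b * (b ^ k - 1) ^ 2)"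
        using m_gt unfolding pb m_def by (cases "pval P (b ^ k - 1)") (simp_all add: pval_power[OF prime_P] va numeral_eq_enat)
      ultimately have "pval P (c 2) = pval P (a ^ 2)"
        by (simp only: pval_add_eq_left[OF prime_P])
      then show ?case
        by (simp add: pval_power[OF prime_P] va flip: numeral_2_eq_2)
    next
      case (Suc n)
      have "c (Suc (Suc (Suc n))) = b * c (Suc (Suc n)) ^ 2 + a ^ (2 ^ Suc (Suc (Suc n)) - 2)"
        using c[rule_format, of "Suc (Suc (Suc n))"] by (simp add: add.commute)
      moreover have v: "pval P (b * c (Suc (Suc n)) ^ 2) = enat (2 ^ Suc (Suc n) * e1)"
        unfolding pb Suc.IH by (simp add: numeral_eq_enat)
      moreover have "(2 :: nat) ^ Suc (Suc n) < 2 ^ Suc (Suc (Suc n)) - 2"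
        using one_le_power[of "2 :: nat" n] unfolding power_Suc by linarith
      then have "pval P (b * c (Suc (Suc n)) ^ 2) < pval P (a ^ (2 ^ Suc (Suc (Suc n)) - 2))"
        unfolding v using pos by (simp add: pval_power[OF prime_P] va del: power_Suc)
      ultimately show ?case
        using pval_add_eq_left[OF prime_P] by simp
    qed
    then have "enat (level i) = min (enat ((2 ^ Suc i - 1) * e1)) (enat (2 ^ i * e1))"
      using formula[OF c1 c, of i] Suc by simp
    moreover have "(2 ^ i * e1) \<le> (2 ^ Suc i - 1) * e1"
      using one_le_power[of "2 :: nat" i] by (intro mult_le_mono1) simp
    ultimately show ?thesis
      by (simp only: min_absorb2 enat_ord_simps enat.inject)
  qed
qed

end


section \<open>The period jumps\<close>

theorem theorem4p12:
  fixes a b P :: "'a::{field,finite} poly" and p l :: nat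
  assumes "prime p" and "l \<ge> 1" and "card (UNIV :: 'a set) = p ^ l"
    and "b \<noteq> 0"
    and "irreducible P" and "coprime b P"
    and "\<not> (degree a = 0 \<and> degree b = 0)"
  shows "\<exists>e' :: nat \<Rightarrow> nat.
    (\<forall>i\<ge>1. is_ith_smallest i (period_jumps a b P) (e' i)) \<and>
    \<comment> \<open>(a)\<close>
    (fib_discr a b = 0 \<longrightarrow> \<not> (\<exists>e1. is_ith_smallest 1 (rank_jumps a b P) e1)) \<and>
    (\<not> (\<exists>e1. is_ith_smallest 1 (rank_jumps a b P) e1) \<longrightarrow>
       (\<forall>i\<ge>1. e' i = p ^ (i - 1) * e' 1)) \<and>
    \<comment> \<open>(b)\<close>
    (\<forall>e1. is_ith_smallest 1 (rank_jumps a b P) e1 \<and> e' 1 < e1 \<longrightarrow>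
       (\<forall>i\<ge>1. e' i = p ^ (i - 1) * e' 1)) \<and>
    \<comment> \<open>(c)\<close>
    (\<not> [fib_discr a b = 0] (mod P) \<longrightarrow>
       (\<forall>i\<ge>1. e' i = p ^ (i - 1) * e' 1)) \<and>
    \<comment> \<open>(d)\<close>
    (\<forall>e1. p > 2 \<and> [fib_discr a b = 0] (mod P) \<and>
          is_ith_smallest 1 (rank_jumps a b P) e1 \<and> e' 1 = e1 \<longrightarrow>
       (let k = poly_ord P (smult (1 / 2) a);
            m = pval P (smult (1 / 2) a ^ k - 1)
        in \<forall>i\<ge>2. enat (e' i) = min (m * enat (p ^ i)) (enat ((p ^ i - 1) * e1 div (p - 1))))) \<and>
    \<comment> \<open>(e)\<close>
    (\<forall>e1. p = 2 \<and> [fib_discr a b = 0] (mod P) \<and>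
          is_ith_smallest 1 (rank_jumps a b P) e1 \<and> e' 1 = e1 \<longrightarrow>
       (let k = poly_ord P b;
            m = pval P (b ^ k - 1)
        in m \<ge> enat e1 \<and>
           (m > enat e1 \<longrightarrow> (\<forall>i\<ge>2. e' i = 2 ^ (i - 1) * e1)) \<and>
           (m = enat e1 \<longrightarrow>
              (\<forall>c :: nat \<Rightarrow> 'a poly.
                 c 1 = b ^ k - 1 \<and>
                 (\<forall>i\<ge>2. c i = a ^ (2 ^ i - 2) + b * c (i - 1) ^ 2) \<longrightarrow>
                 (\<forall>i\<ge>2. enat (e' i) = min (enat ((2 ^ i - 1) * e1)) (pval P (c i)))))))"
proof -
  interpret fib_mod_prime a b P p
    by (rule fib_mod_prime.intro[OF CHAR_eq_of_card[OF assms(1,3)] assms(5-7)])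
  note jump = first_rank_jump_iff
  have no_jump: "gfib a b rk = 0" if "\<not> (\<exists>e1. is_ith_smallest 1 (rank_jumps a b P) e1)"
    using that unfolding jump pval_eq_infinity_iff[of P, symmetric] by (metis not_infinity_eq)
  have Suc_index: "i \<ge> 1 \<Longrightarrow> Suc (i - 1) = i" for i :: nat
    by simp
  show ?thesis
  proof (intro exI[of _ "\<lambda>i. level (i - 1)"] conjI allI impI)
    fix i :: nat assume "i \<ge> 1"
    then show "is_ith_smallest i (period_jumps a b P) (level (i - 1))"
      unfolding period_jumps_eq by (rule is_ith_smallest_range[OF strict_mono_level])
  next
    assume "fib_discr a b = 0"
    then have "pval P (gfib a b rk) = \<infinity>"
      by (simp add: gfib_rank_eq_0_of_discr pval_eq_infinity_iff)
    then show "\<not> (\<exists>e1. is_ith_smallest 1 (rank_jumps a b P) e1)"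
      unfolding jump by simp
  next
    fix i assume "\<not> (\<exists>e1. is_ith_smallest 1 (rank_jumps a b P) e1)"
    then show "level (i - 1) = p ^ (i - 1) * level (1 - 1)"
      using level_geometric_of_rank[of "i - 1"] no_jump by simp
  next
    fix e1 i assume *: "is_ith_smallest 1 (rank_jumps a b P) e1 \<and> level (1 - 1) < e1"
    then have "enat (Suc (level 0)) \<le> pval P (gfib a b rk)"
      unfolding jump by simp
    then show "level (i - 1) = p ^ (i - 1) * level (1 - 1)"
      using level_geometric_of_rank[of "i - 1"] unfolding pval_ge_iff[OF prime_P] by simp
  next
    fix i assume "\<not> [fib_discr a b = 0] (mod P)"
    then show "level (i - 1) = p ^ (i - 1) * level (1 - 1)"
      using level_geometric_of_discr[of "i - 1"] by (simp add: cong_0_iff)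
  next
    fix e1
    assume *: "p > 2 \<and> [fib_discr a b = 0] (mod P) \<and>
      is_ith_smallest 1 (rank_jumps a b P) e1 \<and> level (1 - 1) = e1"
    then have formula: "enat (level i)
        = min (pval P (smult (1 / 2) a ^ poly_ord P (smult (1 / 2) a) - 1) * enat (p ^ Suc i))
            (enat ((p ^ Suc i - 1) * e1 div (p - 1)))" for i
      by (intro level_odd_ramified_formula) (auto simp: cong_0_iff jump[symmetric])
    have "enat (level (i - 1))
        = min (pval P (smult (1 / 2) a ^ poly_ord P (smult (1 / 2) a) - 1) * enat (p ^ i))
            (enat ((p ^ i - 1) * e1 div (p - 1)))" if "i \<ge> 2" for i
      using formula[of "i - 1"] Suc_index[of i] that by (simp del: power_Suc)
    then show "let k = poly_ord P (smult (1 / 2) a); m = pval P (smult (1 / 2) a ^ k - 1)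
      in \<forall>i\<ge>2. enat (level (i - 1)) = min (m * enat (p ^ i)) (enat ((p ^ i - 1) * e1 div (p - 1)))"
      unfolding Let_def by blast
  next
    fix e1
    assume *: "p = 2 \<and> [fib_discr a b = 0] (mod P) \<and>
      is_ith_smallest 1 (rank_jumps a b P) e1 \<and> level (1 - 1) = e1"
    then have "p = 2" "P dvd fib_discr a b" "pval P (gfib a b rk) = enat e1" "level 0 = e1"
      unfolding jump cong_0_iff diff_self_eq_0 by blast+
    note formulas = level_char_2_formulas[OF this]
    let ?k = "poly_ord P b"
    have "enat e1 \<le> pval P (b ^ ?k - 1)"
      by (rule formulas(1))
    moreover have "level (i - 1) = 2 ^ (i - 1) * e1" if "pval P (b ^ ?k - 1) > enat e1" for i
      using that by (rule formulas(3))
    moreover have "enat (level (i - 1)) = min (enat ((2 ^ i - 1) * e1)) (pval P (c i))"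
      if "c 1 = b ^ ?k - 1" "\<forall>i\<ge>2. c i = a ^ (2 ^ i - 2) + b * c (i - 1) ^ 2" "i \<ge> 2" for c i
      using formulas(2)[OF that(1,2), of "i - 1"] Suc_index[of i] that(3) by simp
    ultimately show "let k = poly_ord P b; m = pval P (b ^ k - 1)
        in m \<ge> enat e1 \<and>
           (m > enat e1 \<longrightarrow> (\<forall>i\<ge>2. level (i - 1) = 2 ^ (i - 1) * e1)) \<and>
           (m = enat e1 \<longrightarrow>
              (\<forall>c :: nat \<Rightarrow> 'a poly.
                 c 1 = b ^ k - 1 \<and>
                 (\<forall>i\<ge>2. c i = a ^ (2 ^ i - 2) + b * c (i - 1) ^ 2) \<longrightarrow>
                 (\<forall>i\<ge>2. enat (level (i - 1)) = min (enat ((2 ^ i - 1) * e1)) (pval P (c i)))))"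
      unfolding Let_def by blast
  qed
qed

end
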